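(* Let $N\ge1$, $0<s<1$ and $p=p_c:=\frac{2N}{N+s}$. Let $u(x,t)\ge0$ be the semigroup solution of the Cauchy problem in $\mathbb{R}^N\times(0,\infty)$ for the fractional $p$-Laplacian evolution equation $\partial_t u+\mathcal{L}_{s,p}u=0$ with initial datum $u_0\in L^1(\mathbb{R}^N)$, $u_0\ge0$. Under the further assumption that $s\,p_c<1$, for every $t>0$ the mass is conserved: $$\int_{\mathbb{R}^N}u(x,t)\,dx=\int_{\mathbb{R}^N}u_0(x)\,dx .$$
   Context: The $s$-fractional $p$-Laplacian operator is $$\mathcal{L}_{s,p}(f)(x)=\mathrm{P.V.}\int_{\mathbb{R}^N}\frac{\Phi(f(x)-f(y))}{|x-y|^{N+sp}}\,dy,\qquad \Phi(z)=|z|^{p-2}z,$$ i.e. the subdifferential in $L^2(\mathbb{R}^N)$ of the functional $\frac{1}{p}\iint\frac{|f(x)-f(y)|^p}{|x-y|^{N+sp}}\,dx\,dy$, up to an irrelevant positive multiplicative constant. The equation generates a continuous nonlinear semigroup, non-expansive in every $L^q(\mathbb{R}^N)$, $1\le q<\infty$ (the $L^2$ gradient flow, extended by density); the semigroup solution with datum $u_0\in L^1(\mathbb{R}^N)$ is the orbit $u\in C([0,\infty);L^1(\mathbb{R}^N))$ of this semigroup in $L^1$ with $u(0)=u_0$. Nonnegative data give nonnegative solutions. *)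

theory Defs
  imports "HOL-Analysis.Analysis"
begin

text \<open>Elements of the Lebesgue spaces are represented by Borel functions; everything below is
  invariant under changes on null sets, so that an \<open>L\<^sup>q\<close>-valued curve is a function
  \<open>real \<Rightarrow> 'a \<Rightarrow> real\<close>, used only at times \<open>t \<ge> 0\<close>.\<close>

definition Lq_space :: "real \<Rightarrow> ('a::euclidean_space \<Rightarrow> real) set" where
  "Lq_space q = {f \<in> borel_measurable lborel. integrable lborel (\<lambda>x. \<bar>f x\<bar> powr q)}"

definition Lq_norm :: "real \<Rightarrow> ('a::euclidean_space \<Rightarrow> real) \<Rightarrow> real" where
  "Lq_norm q f = (\<integral>x. \<bar>f x\<bar> powr q \<partial>lborel) powr (1 / q)"

definition Lq_dist ::
    "real \<Rightarrow> ('a::euclidean_space \<Rightarrow> real) \<Rightarrow> ('a \<Rightarrow> real) \<Rightarrow> real" where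
  "Lq_dist q f g = Lq_norm q (\<lambda>x. f x - g x)"

definition continuous_Lq_curve ::
    "real \<Rightarrow> (real \<Rightarrow> 'a::euclidean_space \<Rightarrow> real) \<Rightarrow> bool" where
  "continuous_Lq_curve q u \<longleftrightarrow>
     (\<forall>t\<ge>0. u t \<in> Lq_space q) \<and>
     (\<forall>t\<ge>0. ((\<lambda>r. Lq_dist q (u r) (u t)) \<longlongrightarrow> 0) (at t within {0..}))"

text \<open>The divisions below are finite families of nonoverlapping intervals \<open>[c, d]\<close>, and
  \<open>Inf K\<close>, \<open>Sup K\<close> are the endpoints of such an interval \<open>K\<close>.\<close>

definition abs_continuous_Lq_on ::
    "real \<Rightarrow> real set \<Rightarrow> (real \<Rightarrow> 'a::euclidean_space \<Rightarrow> real) \<Rightarrow> bool" where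
  "abs_continuous_Lq_on q S u \<longleftrightarrow>
     (\<forall>\<epsilon>>0. \<exists>\<delta>>0. \<forall>D. D division_of (\<Union>D) \<and> \<Union>D \<subseteq> S \<and> (\<Sum>K\<in>D. Sup K - Inf K) < \<delta>
        \<longrightarrow> (\<Sum>K\<in>D. Lq_dist q (u (Sup K)) (u (Inf K))) < \<epsilon>)"

definition has_Lq_derivative ::
    "real \<Rightarrow> (real \<Rightarrow> 'a::euclidean_space \<Rightarrow> real) \<Rightarrow> ('a \<Rightarrow> real) \<Rightarrow> real \<Rightarrow> bool" where
  "has_Lq_derivative q u w t \<longleftrightarrow>
     ((\<lambda>r. Lq_dist q (\<lambda>x. (u r x - u t x) / (r - t)) w) \<longlongrightarrow> 0) (at t)"

definition L2_subdifferential ::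
    "(('a::euclidean_space \<Rightarrow> real) \<Rightarrow> ereal) \<Rightarrow> ('a \<Rightarrow> real) \<Rightarrow> ('a \<Rightarrow> real) set" where
  "L2_subdifferential F f =
     {\<xi> \<in> Lq_space 2. f \<in> Lq_space 2 \<and> F f < \<infinity> \<and>
        (\<forall>g\<in>Lq_space 2. F f + ereal (\<integral>x. \<xi> x * (g x - f x) \<partial>lborel) \<le> F g)}"

text \<open>The integrand vanishes on the (null) diagonal, since \<open>0 powr a = 0\<close> and \<open>0 / 0 = 0\<close>.\<close>

definition frac_p_energy ::
    "real \<Rightarrow> real \<Rightarrow> ('a::euclidean_space \<Rightarrow> real) \<Rightarrow> ereal" where
  "frac_p_energy s p f = enn2ereal (ennreal (1 / p) *
     (\<integral>\<^sup>+(x, y). ennreal (\<bar>f x - f y\<bar> powr p / norm (x - y) powr (real DIM('a) + s * p))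
        \<partial>(lborel \<Otimes>\<^sub>M lborel)))"

text \<open>The first variation of the energy at \<open>f\<close> in the direction \<open>g\<close> is
  \<open>\<integral>\<integral> \<Phi>(f x - f y) (g x - g y) / |x - y|^(N+sp) dx dy = 2 \<integral> L(f) g dx\<close>, where
  \<open>\<Phi>(z) = |z|^(p-2) z\<close> and \<open>L(f)(x) = P.V. \<integral> \<Phi>(f x - f y) / |x - y|^(N+sp) dy\<close>;
  hence the operator \<open>L\<close> is one half of the subdifferential.\<close>

definition frac_p_Laplacian ::
    "real \<Rightarrow> real \<Rightarrow> ('a::euclidean_space \<Rightarrow> real) \<Rightarrow> ('a \<Rightarrow> real) set" where
  "frac_p_Laplacian s p f = {\<eta>. (\<lambda>x. 2 * \<eta> x) \<in> L2_subdifferential (frac_p_energy s p) f}"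

text \<open>Strong solutions in the sense of the theory of gradient flows in Hilbert spaces.\<close>

definition L2_gradient_flow ::
    "real \<Rightarrow> real \<Rightarrow> (real \<Rightarrow> 'a::euclidean_space \<Rightarrow> real) \<Rightarrow> bool" where
  "L2_gradient_flow s p v \<longleftrightarrow>
     continuous_Lq_curve 2 v \<and>
     (\<forall>a b. 0 < a \<and> a < b \<longrightarrow> abs_continuous_Lq_on 2 {a..b} v) \<and>
     (AE t in lborel. 0 < t \<longrightarrow>
        (\<exists>w\<in>Lq_space 2. has_Lq_derivative 2 v w t \<and> (\<lambda>x. - w x) \<in> frac_p_Laplacian s p (v t)))"

text \<open>The \<open>L\<^sup>1\<close> semigroup is the extension by density of the \<open>L\<^sup>2\<close> gradient flow on
  \<open>L\<^sup>1 \<inter> L\<^sup>2\<close>: its orbits are the limits in \<open>L\<^sup>1\<close>, at every time, of gradient flow orbits whose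
  data (the case \<open>t = 0\<close>) converge in \<open>L\<^sup>1\<close>. As the flow is non-expansive in \<open>L\<^sup>1\<close>, the limit
  does not depend on the approximating sequence.\<close>

definition L1_semigroup_solution ::
    "real \<Rightarrow> real \<Rightarrow> ('a::euclidean_space \<Rightarrow> real) \<Rightarrow> (real \<Rightarrow> 'a \<Rightarrow> real) \<Rightarrow> bool" where
  "L1_semigroup_solution s p u0 u \<longleftrightarrow>
     continuous_Lq_curve 1 u \<and> (AE x in lborel. u 0 x = u0 x) \<and>
     (\<exists>v :: nat \<Rightarrow> real \<Rightarrow> 'a \<Rightarrow> real.
        (\<forall>n. L2_gradient_flow s p (v n)) \<and>
        (\<forall>n. \<forall>t\<ge>0. v n t \<in> Lq_space 1) \<and>
        (\<forall>t\<ge>0. (\<lambda>n. Lq_dist 1 (v n t) (u t)) \<longlonglongrightarrow> 0))"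

end

theory Submission
  imports Defs
begin

text \<open>Write \<open>N = DIM('a)\<close>, \<open>\<sigma> = s p\<close> and \<open>q = p - 1 \<in> (0, 1)\<close>. Let \<open>\<phi>\<^sub>R\<close> be a cutoff function which is
\<open>1\<close> on the ball of radius \<open>R\<close>, vanishes off the ball of radius \<open>2 R\<close> and has Lipschitz constant \<open>1 / R\<close>.
Testing the equation with \<open>\<phi>\<^sub>R\<close> shows that \<open>\<integral> \<phi>\<^sub>R v(t)\<close> changes at a rate bounded by
\<open>T\<^sub>R(v(t)) = \<integral> |v(t)|^q M\<^sub>R\<close>, where \<open>M\<^sub>R(x) = \<integral> |\<phi>\<^sub>R x - \<phi>\<^sub>R y| / |x - y|^(N + \<sigma>) dy\<close>
(\<open>subgradient_cutoff_le\<close>). So mass is conserved by a flow \<open>v\<close> as soon as \<open>T\<^sub>R(v(t))\<close> tends to \<open>0\<close>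
for \<open>R \<rightarrow> \<infinity>\<close>, boundedly in time.

Since \<open>\<sigma> < 1\<close>, the kernel \<open>min 1 (|z| / R) / |z|^(N + \<sigma>)\<close> is integrable with integral of order
\<open>R^(-\<sigma>)\<close>. Hence \<open>M\<^sub>R\<close> is at most of order \<open>R^(-\<sigma>)\<close> and its integral at most of order \<open>R^(N - \<sigma>)\<close>.
Inserting \<open>|f|^q \<le> l^q + l^(q - 1) |f|\<close> with \<open>l = \<mu> R^(-N)\<close> makes all powers of \<open>R\<close> cancel, precisely
because the critical exponent satisfies \<open>N (1 - q) = \<sigma>\<close>; what remains is
\<open>\<integral>\<^bsub>S\<^esub> |f|^q M\<^sub>R \<le> K (c \<mu>^q + \<mu>^(q - 1) \<integral>\<^bsub>S\<^esub> |f|)\<close>, uniformly in \<open>R\<close>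
(\<open>nn_integral_powr_cutoff_variation_le\<close>). Thus \<open>T\<^sub>R(f)\<close> is bounded in terms of the \<open>L\<^sup>1\<close> norm of \<open>f\<close>.
It also tends to \<open>0\<close>: outside a large ball the \<open>L\<^sup>1\<close> mass of \<open>f\<close> is negligible and \<open>\<mu>\<close> may be taken
small, while on a fixed ball the factor \<open>R^(-\<sigma>)\<close> decays (\<open>powr_cutoff_variation_vanishes\<close>).

The bound has to be uniform in time, so the \<open>L\<^sup>1\<close> norm of a flow must not increase. For a nondecreasing
Lipschitz function \<open>\<beta>\<close> with \<open>\<beta>(0) = 0\<close> and small \<open>k\<close> the map \<open>f \<mapsto> f - k \<beta>(f)\<close> shrinks all differences
and so does not increase the energy; the subgradient inequality then gives \<open>\<integral> \<xi> \<beta>(f) \<ge> 0\<close>, which is the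
dissipation of \<open>\<integral> j(v(t))\<close> for \<open>j' = \<beta>\<close>. Letting \<open>j\<close> increase to the absolute value yields
\<open>gradient_flow_L1_norm_le\<close>.

Both time derivatives exist only almost everywhere. They are integrated by a fundamental theorem for
absolutely continuous functions in terms of the gauge integral, whose dominated convergence theorem
asks of the derivatives only that they be integrable. This proves that the mass of a flow is the same at
all positive times (\<open>gradient_flow_mass_eq\<close>). The property passes to \<open>L\<^sup>1\<close> limits, and the initial
time is reached by the continuity of the limit curve in \<open>L\<^sup>1\<close>, so the flows themselves need only be
controlled away from \<open>t = 0\<close>.\<close>


section \<open>Elementary facts on the spaces of integrable and square integrable functions\<close>

lemma Lq_space_2_iff:
  "f \<in> Lq_space 2 \<longleftrightarrow> f \<in> borel_measurable borel \<and> integrable lborel (\<lambda>x. (f x)\<^sup>2)"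
  by (simp add: Lq_space_def)

lemma Lq_space_1_iff: "f \<in> Lq_space 1 \<longleftrightarrow> integrable lborel f"
  by (auto simp: Lq_space_def integrable_abs_iff dest: borel_measurable_integrable)

lemma measurable_Lq_space: "f \<in> Lq_space q \<Longrightarrow> f \<in> borel_measurable borel"
  by (simp add: Lq_space_def)

lemma Lq_norm_2: "Lq_norm 2 f = sqrt (\<integral>x. (f x)\<^sup>2 \<partial>lborel)"
  by (simp add: Lq_norm_def powr_half_sqrt)

lemma Lq_dist_1: "Lq_dist 1 f g = (\<integral>x. \<bar>f x - g x\<bar> \<partial>lborel)"
  by (simp add: Lq_dist_def Lq_norm_def)

lemma Lq_norm_nonneg: "0 \<le> Lq_norm q f" and Lq_dist_nonneg: "0 \<le> Lq_dist q f g"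
  by (simp_all add: Lq_norm_def Lq_dist_def)

lemma Lq_dist_commute: "Lq_dist q f g = Lq_dist q g f"
  by (simp add: Lq_dist_def Lq_norm_def abs_minus_commute)

lemma abs_integral_diff_le_Lq_dist_1:
  assumes "f \<in> Lq_space 1" "g \<in> Lq_space 1"
  shows "\<bar>(\<integral>x. f x \<partial>lborel) - (\<integral>x. g x \<partial>lborel)\<bar> \<le> Lq_dist 1 f g"
proof -
  have "(\<integral>x. f x \<partial>lborel) - (\<integral>x. g x \<partial>lborel) = (\<integral>x. f x - g x \<partial>lborel)"
    using assms by (simp add: Lq_space_1_iff)
  then show ?thesis using integral_abs_bound[of lborel "\<lambda>x. f x - g x"] by (simp add: Lq_dist_1)
qed

lemma L2_mult_integrable:
  assumes "f \<in> Lq_space 2" "g \<in> Lq_space 2"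
  shows "integrable lborel (\<lambda>x. f x * g x)"
proof (rule Bochner_Integration.integrable_bound)
  show "integrable lborel (\<lambda>x. (f x)\<^sup>2 + (g x)\<^sup>2)"
    using assms by (auto simp: Lq_space_2_iff)
  show "(\<lambda>x. f x * g x) \<in> borel_measurable lborel"
    using assms by (auto simp: Lq_space_2_iff)
  have "\<bar>a * b\<bar> \<le> a\<^sup>2 + b\<^sup>2" for a b :: real
  proof -
    have "2 * \<bar>a\<bar> * \<bar>b\<bar> \<le> a\<^sup>2 + b\<^sup>2" using sum_squares_bound[of "\<bar>a\<bar>" "\<bar>b\<bar>"] by simp
    moreover have "0 \<le> \<bar>a\<bar> * \<bar>b\<bar>" by simp
    ultimately show ?thesis unfolding abs_mult by linarith
  qed
  then show "AE x in lborel. norm (f x * g x) \<le> norm ((f x)\<^sup>2 + (g x)\<^sup>2)" by simp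
qed

lemma L2_lincomb:
  assumes "f \<in> Lq_space 2" "g \<in> Lq_space 2"
  shows "(\<lambda>x. a * f x + b * g x) \<in> Lq_space 2"
proof -
  have "integrable lborel (\<lambda>x. a\<^sup>2 * (f x)\<^sup>2 + (2 * a * b) * (f x * g x) + b\<^sup>2 * (g x)\<^sup>2)"
    using assms L2_mult_integrable[OF assms] by (auto simp: Lq_space_2_iff)
  moreover have "a\<^sup>2 * (f x)\<^sup>2 + (2 * a * b) * (f x * g x) + b\<^sup>2 * (g x)\<^sup>2 = (a * f x + b * g x)\<^sup>2" for x
    by (simp add: power2_eq_square algebra_simps)
  ultimately show ?thesis using assms by (auto simp: Lq_space_2_iff)
qed

lemma L2_diff:
  assumes "f \<in> Lq_space 2" "g \<in> Lq_space 2"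
  shows "(\<lambda>x. f x - g x) \<in> Lq_space 2"
  using L2_lincomb[OF assms, of 1 "-1"] by simp

lemma L2_mono:
  assumes "g \<in> Lq_space 2" "f \<in> borel_measurable borel" "\<And>x. \<bar>f x\<bar> \<le> c * \<bar>g x\<bar>"
  shows "f \<in> Lq_space 2"
proof -
  have "integrable lborel (\<lambda>x. (f x)\<^sup>2)"
  proof (rule Bochner_Integration.integrable_bound)
    show "integrable lborel (\<lambda>x. c\<^sup>2 * (g x)\<^sup>2)" using assms(1) by (auto simp: Lq_space_2_iff)
    show "(\<lambda>x. (f x)\<^sup>2) \<in> borel_measurable lborel" using assms(2) by simp
    have "(f x)\<^sup>2 \<le> c\<^sup>2 * (g x)\<^sup>2" for x
      using power_mono[OF assms(3)[of x], of 2] by (simp add: power_mult_distrib)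
    then show "AE x in lborel. norm ((f x)\<^sup>2) \<le> norm (c\<^sup>2 * (g x)\<^sup>2)" by simp
  qed
  then show ?thesis using assms(2) by (simp add: Lq_space_2_iff)
qed

lemma L2_quotient:
  assumes "f \<in> Lq_space 2" "g \<in> Lq_space 2"
  shows "(\<lambda>x. (f x - g x) / h) \<in> Lq_space 2"
  using L2_lincomb[OF assms, of "1 / h" "- 1 / h"] by (simp add: diff_divide_distrib)

text \<open>The quadratic \<open>t \<mapsto> \<integral> (f + t g)\<^sup>2\<close> is nonnegative; evaluate it at its minimum, or, if it is affine,
far out on the side where it would become negative.\<close>

lemma L2_Cauchy_Schwarz:
  assumes f: "f \<in> Lq_space 2" and g: "g \<in> Lq_space 2"
  shows "\<bar>\<integral>x. f x * g x \<partial>lborel\<bar> \<le> Lq_norm 2 f * Lq_norm 2 g"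
proof -
  define F where "F = (\<integral>x. (f x)\<^sup>2 \<partial>lborel)"
  define G where "G = (\<integral>x. (g x)\<^sup>2 \<partial>lborel)"
  define H where "H = (\<integral>x. f x * g x \<partial>lborel)"
  have G0: "G \<ge> 0" and F0: "F \<ge> 0" by (simp_all add: G_def F_def)
  have quad: "0 \<le> F + 2 * t * H + t\<^sup>2 * G" for t
  proof -
    have "0 \<le> (\<integral>x. (f x + t * g x)\<^sup>2 \<partial>lborel)" by simp
    also have "\<dots> = (\<integral>x. (f x)\<^sup>2 + (2 * t) * (f x * g x) + t\<^sup>2 * (g x)\<^sup>2 \<partial>lborel)"
      by (intro Bochner_Integration.integral_cong) (auto simp: power2_eq_square algebra_simps)
    also have "\<dots> = F + 2 * t * H + t\<^sup>2 * G"
      using f g L2_mult_integrable[OF f g] by (simp add: Lq_space_2_iff F_def G_def H_def)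
    finally show ?thesis .
  qed
  have "H\<^sup>2 \<le> F * G"
  proof (cases "G = 0")
    case True
    have "H = 0"
    proof (rule ccontr)
      assume "H \<noteq> 0"
      then show False using quad[of "- (F + 1) / (2 * H)"] True by (simp add: field_simps)
    qed
    then show ?thesis using True by simp
  next
    case False
    then have "G > 0" using G0 by simp
    then show ?thesis using quad[of "- H / G"] by (simp add: power2_eq_square field_simps)
  qed
  then have "\<bar>H\<bar> \<le> sqrt (F * G)" by (metis real_sqrt_abs real_sqrt_le_mono)
  then show ?thesis by (simp add: H_def F_def G_def Lq_norm_2 real_sqrt_mult)
qed

lemma L2_norm_triangle:
  assumes f: "f \<in> Lq_space 2" and g: "g \<in> Lq_space 2"
  shows "Lq_norm 2 (\<lambda>x. f x + g x) \<le> Lq_norm 2 f + Lq_norm 2 g"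
proof -
  have sq: "(Lq_norm 2 h)\<^sup>2 = (\<integral>x. (h x)\<^sup>2 \<partial>lborel)" for h :: "'a \<Rightarrow> real"
    by (simp add: Lq_norm_2)
  have "(Lq_norm 2 (\<lambda>x. f x + g x))\<^sup>2 = (\<integral>x. (f x)\<^sup>2 + 2 * (f x * g x) + (g x)\<^sup>2 \<partial>lborel)"
    unfolding sq by (intro Bochner_Integration.integral_cong) (auto simp: power2_eq_square algebra_simps)
  also have "\<dots> = (Lq_norm 2 f)\<^sup>2 + 2 * (\<integral>x. f x * g x \<partial>lborel) + (Lq_norm 2 g)\<^sup>2"
    unfolding sq using f g L2_mult_integrable[OF f g] by (simp add: Lq_space_2_iff)
  also have "\<dots> \<le> (Lq_norm 2 f + Lq_norm 2 g)\<^sup>2"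
    using L2_Cauchy_Schwarz[OF f g] unfolding power2_sum by simp
  finally show ?thesis
    by (rule power2_le_imp_le) (simp add: Lq_norm_nonneg)
qed

lemma L2_norm_le_dist:
  assumes f: "f \<in> Lq_space 2" and g: "g \<in> Lq_space 2"
  shows "Lq_norm 2 f \<le> Lq_dist 2 f g + Lq_norm 2 g"
  using L2_norm_triangle[OF L2_diff[OF f g] g] by (simp add: Lq_dist_def)


section \<open>Absolutely continuous functions of time\<close>

text \<open>The fundamental theorem of calculus for absolutely continuous functions. Taking the gauge integral
makes the proof direct. At the points of differentiability the gauge makes the increments of \<open>g\<close> over tagged
intervals agree with \<open>D t\<close> times the length, up to a small multiple of the length. At the exceptional points the
gauge confines the intervals to an open set of small measure, and absolute continuity bounds the sum of these
increments. Absolute continuity is stated with the same families of intervals as for curves in \<open>L\<^sup>q\<close>.\<close>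

lemma absolutely_continuous_has_integral_derivative:
  fixes g D :: "real \<Rightarrow> real"
  assumes ab: "a \<le> b"
    and ac: "\<And>\<epsilon>. \<epsilon> > 0 \<Longrightarrow> \<exists>\<delta>>0. \<forall>\<D>. \<D> division_of (\<Union>\<D>) \<and> \<Union>\<D> \<subseteq> {a..b} \<and>
        (\<Sum>K\<in>\<D>. Sup K - Inf K) < \<delta> \<longrightarrow> (\<Sum>K\<in>\<D>. \<bar>g (Sup K) - g (Inf K)\<bar>) < \<epsilon>"
    and null: "N \<in> null_sets lborel"
    and deriv: "\<And>t. t \<in> {a..b} - N \<Longrightarrow> (g has_real_derivative D t) (at t)"
    and zero: "\<And>t. t \<in> N \<Longrightarrow> D t = 0"
  shows "(D has_integral (g b - g a)) {a..b}"
  unfolding has_integral_real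
proof (intro allI impI)
  fix e :: real assume e: "e > 0"
  \<comment> \<open>The \<open>+ 1\<close> covers the case \<open>a = b\<close>.\<close>
  define e' where "e' = e / (4 * (b - a + 1))"
  have e': "e' > 0" using e ab by (auto simp: e'_def)
  obtain \<delta> where \<delta>: "\<delta> > 0" and ac': "\<And>\<D>. \<D> division_of (\<Union>\<D>) \<Longrightarrow> \<Union>\<D> \<subseteq> {a..b} \<Longrightarrow>
        (\<Sum>K\<in>\<D>. Sup K - Inf K) < \<delta> \<Longrightarrow> (\<Sum>K\<in>\<D>. \<bar>g (Sup K) - g (Inf K)\<bar>) < e / 2"
  proof -
    have "e / 2 > 0" using e by simp
    from ac[OF this] show ?thesis using that by blast
  qed
  have Nb: "N \<in> sets borel" using null by (auto simp: null_sets_def)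
  obtain U where U: "open U" "N \<subseteq> U" "emeasure lborel (U - N) < ennreal \<delta>"
    using outer_regular_lborel[OF Nb \<delta>] by metis
  have UN: "(U - N) \<union> N = U" using U(2) by blast
  have Um: "emeasure lborel U < ennreal \<delta>"
  proof -
    have "U - N \<in> sets lborel" using U(1) Nb by auto
    from emeasure_Un_null_set[OF this null] have "emeasure lborel U = emeasure lborel (U - N)"
      by (simp only: UN)
    then show ?thesis using U(3) by simp
  qed
  have "\<exists>r>0. \<forall>y. \<bar>y - t\<bar> < r \<longrightarrow> \<bar>g y - g t - D t * (y - t)\<bar> \<le> e' * \<bar>y - t\<bar>"
    if t: "t \<in> {a..b} - N" for t
  proof -
    have "(g has_derivative (*) (D t)) (at t)"
      using deriv[OF t] by (simp add: has_field_derivative_def)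
    then have "\<forall>\<epsilon>>0. \<exists>d>0. \<forall>y. norm (y - t) < d \<longrightarrow> norm (g y - g t - D t * (y - t)) \<le> \<epsilon> * norm (y - t)"
      by (simp add: has_derivative_at_alt)
    then show ?thesis using e' by simp
  qed
  then have "\<forall>t\<in>{a..b} - N. \<exists>r>0. \<forall>y. \<bar>y - t\<bar> < r \<longrightarrow> \<bar>g y - g t - D t * (y - t)\<bar> \<le> e' * \<bar>y - t\<bar>"
    by blast
  from bchoice[OF this] obtain r where r: "\<And>t. t \<in> {a..b} - N \<Longrightarrow> r t > 0"
      "\<And>t y. t \<in> {a..b} - N \<Longrightarrow> \<bar>y - t\<bar> < r t \<Longrightarrow> \<bar>g y - g t - D t * (y - t)\<bar> \<le> e' * \<bar>y - t\<bar>"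
    by blast
  define \<gamma> where "\<gamma> t = (if t \<in> N then U else if t \<in> {a..b} then ball t (r t) else ball t 1)" for t
  have \<gamma>: "gauge \<gamma>"
    unfolding gauge_def \<gamma>_def using U r(1) by auto
  show "\<exists>\<gamma>. gauge \<gamma> \<and>
      (\<forall>\<D>. \<D> tagged_division_of {a..b} \<and> \<gamma> fine \<D> \<longrightarrow>
        norm ((\<Sum>(x, k)\<in>\<D>. measure lborel k *\<^sub>R D x) - (g b - g a)) < e)"
  proof (intro exI[of _ \<gamma>] conjI allI impI \<gamma>, elim conjE)
    fix p assume p: "p tagged_division_of {a..b}" and fine: "\<gamma> fine p"
    have fin: "finite p" using p by blast
    have gsum: "g b - g a = (\<Sum>(x,K)\<in>p. g (Sup K) - g (Inf K))"
      and bsum: "b - a = (\<Sum>(x,K)\<in>p. Sup K - Inf K)"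
      using additive_tagged_division_1[OF ab p, of g] additive_tagged_division_1[OF ab p, of "\<lambda>x. x"]
      by auto
    have K: "\<exists>u v. K = {u..v} \<and> u \<le> v \<and> x \<in> {u..v} \<and> {u..v} \<subseteq> {a..b} \<and> {u..v} \<subseteq> \<gamma> x
           \<and> Sup K = v \<and> Inf K = u \<and> measure lborel K = v - u"
      if xK: "(x, K) \<in> p" for x K
    proof -
      obtain u v where uv: "K = {u..v}"
        using tagged_division_ofD(4)[OF p xK] by auto
      have x: "x \<in> K" and sub: "K \<subseteq> {a..b}"
        using tagged_division_ofD(2,3)[OF p xK] by auto
      have "K \<subseteq> \<gamma> x" using fineD[OF fine xK] .
      moreover have "u \<le> v" using x uv by simp
      ultimately show ?thesis using uv x sub by (intro exI[of _ u] exI[of _ v]) simp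
    qed
    \<comment> \<open>the intervals tagged at exceptional points\<close>
    define q where "q = {(x,K)\<in>p. x \<in> N}"
    have qp: "q \<subseteq> p" by (auto simp: q_def)
    have "p tagged_partial_division_of {a..b}" using p by (simp add: tagged_division_of_def)
    then have q: "q tagged_partial_division_of {a..b}"
      by (rule tagged_partial_division_subset[OF _ qp])
    have div: "(snd ` q) division_of \<Union>(snd ` q)" by (rule partial_division_of_tagged_division[OF q])
    have sub: "\<Union>(snd ` q) \<subseteq> {a..b}"
    proof (rule Union_least)
      fix L assume "L \<in> snd ` q"
      then obtain x where "(x, L) \<in> q" by auto
      then show "L \<subseteq> {a..b}" by (rule tagged_partial_division_ofD(3)[OF q])
    qed
    have subU: "\<Union>(snd ` q) \<subseteq> U"
    proof -
      have "L \<subseteq> U" if "(x, L) \<in> q" for x L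
        using fineD[OF fine, of x L] that by (simp add: q_def \<gamma>_def)
      then show ?thesis by force
    qed
    have len: "(\<Sum>K\<in>snd ` q. Sup K - Inf K) < \<delta>"
    proof -
      have "(\<Sum>K\<in>snd ` q. Sup K - Inf K) = (\<Sum>K\<in>snd ` q. measure lebesgue K)"
      proof (rule sum.cong[OF refl])
        fix L assume "L \<in> snd ` q"
        then obtain x where "(x, L) \<in> p" using qp by auto
        from K[OF this] obtain u v where "L = {u..v}" "u \<le> v" "Sup L = v" "Inf L = u" by blast
        then show "Sup L - Inf L = measure lebesgue L" by simp
      qed
      also have "\<dots> = measure lebesgue (\<Union>(snd ` q))"
        by (rule content_division[OF div])
      also have "\<dots> < \<delta>"
      proof -
        have m: "\<Union>(snd ` q) \<in> sets borel"
        proof (intro borel_closed closed_Union ballI)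
          show "finite (snd ` q)" using div by blast
          fix L assume "L \<in> snd ` q"
          then show "closed L" using division_ofD(4)[OF div] by (metis closed_cbox)
        qed
        have "emeasure lborel (\<Union>(snd ` q)) < ennreal \<delta>"
          using emeasure_mono[OF subU, of lborel] U(1) Um by (simp add: order_le_less_trans)
        moreover have "emeasure lborel (\<Union>(snd ` q)) = ennreal (measure lborel (\<Union>(snd ` q)))"
          using calculation by (intro emeasure_eq_ennreal_measure) auto
        ultimately show ?thesis using m \<delta>
          by (simp add: ennreal_less_iff)
      qed
      finally show ?thesis .
    qed
    \<comment> \<open>Two tags may share an interval only if it is degenerate, so passing from tagged intervals to intervals loses nothing.\<close>
    have bad: "(\<Sum>(x,K)\<in>q. \<bar>g (Sup K) - g (Inf K)\<bar>) < e / 2"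
    proof -
      have "(\<Sum>(x,K)\<in>q. \<bar>g (Sup K) - g (Inf K)\<bar>) = (\<Sum>K\<in>snd ` q. \<bar>g (Sup K) - g (Inf K)\<bar>)"
      proof -
        have "sum (\<lambda>K. \<bar>g (Sup K) - g (Inf K)\<bar>) (snd ` q) = sum ((\<lambda>K. \<bar>g (Sup K) - g (Inf K)\<bar>) \<circ> snd) q"
        proof (rule sum.reindex_nontrivial)
          show "finite q" using fin qp finite_subset by blast
          fix z1 z2 assume z: "z1 \<in> q" "z2 \<in> q" "z1 \<noteq> z2" "snd z1 = snd z2"
          then obtain x1 x2 K0 where z': "z1 = (x1,K0)" "z2 = (x2,K0)" "x1 \<noteq> x2" by (metis prod.collapse)
          have "interior K0 = {}"
            using tagged_partial_division_ofD(5)[OF q, of x1 K0 x2 K0] z z' by auto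
          then show "\<bar>g (Sup (snd z1)) - g (Inf (snd z1))\<bar> = 0"
          proof -
            have "(x1,K0) \<in> p" using z(1) z'(1) qp by auto
            from K[OF this] obtain u v where "K0 = {u..v}" "u \<le> v" "Sup K0 = v" "Inf K0 = u" by blast
            then show ?thesis using \<open>interior K0 = {}\<close> z'(1) by simp
          qed
        qed
        then show ?thesis by (simp add: case_prod_unfold o_def)
      qed
      also have "\<dots> < e/2" using ac'[OF div sub len] .
      finally show ?thesis .
    qed
    have tm: "\<bar>measure lborel K * D x - (g (Sup K) - g (Inf K))\<bar>
        \<le> (if x \<in> N then \<bar>g (Sup K) - g (Inf K)\<bar> else 0) + e' * (Sup K - Inf K)"
      if xK: "(x, K) \<in> p" for x K
    proof -
      obtain u v where uv: "K = {u..v}" "u \<le> v" "x \<in> {u..v}" "{u..v} \<subseteq> {a..b}" "{u..v} \<subseteq> \<gamma> x"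
           "Sup K = v" "Inf K = u" "measure lborel K = v - u" using K[OF xK] by blast
      show ?thesis
      proof (cases "x \<in> N")
        case True
        moreover have "0 \<le> e' * (v - u)" using uv(2) e' by simp
        ultimately show ?thesis using uv(6-8) zero[of x] by (simp add: abs_minus_commute)
      next
        case False
        have x: "x \<in> {a..b} - N" using uv False by auto
        have "{u..v} \<subseteq> ball x (r x)" using uv(5) x by (simp add: \<gamma>_def)
        then have "u \<in> ball x (r x)" "v \<in> ball x (r x)" using uv(2) by auto
        then have "\<bar>g u - g x - D x * (u - x)\<bar> \<le> e' * \<bar>u - x\<bar>" "\<bar>g v - g x - D x * (v - x)\<bar> \<le> e' * \<bar>v - x\<bar>"
          using r(2)[OF x] by (auto simp: dist_real_def abs_minus_commute)
        moreover have "\<bar>u - x\<bar> = x - u" "\<bar>v - x\<bar> = v - x" using uv(3) by auto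
        ultimately have "\<bar>g u - g x - D x * (u - x)\<bar> \<le> e' * (x - u)"
            "\<bar>g v - g x - D x * (v - x)\<bar> \<le> e' * (v - x)" by simp_all
        moreover have "e' * (x - u) + e' * (v - x) = e' * (v - u)" by (simp add: algebra_simps)
        moreover have "D x * (v - x) - D x * (u - x) = (v - u) * D x" by (simp add: algebra_simps)
        ultimately have "\<bar>(v - u) * D x - (g v - g u)\<bar> \<le> e' * (v - u)" by linarith
        then show ?thesis using False uv(6-8) by simp
      qed
    qed
    have "norm ((\<Sum>(x, k)\<in>p. measure lborel k *\<^sub>R D x) - (g b - g a))
        = \<bar>\<Sum>(x,K)\<in>p. measure lborel K * D x - (g (Sup K) - g (Inf K))\<bar>"
      unfolding gsum by (simp add: sum_subtractf[symmetric] case_prod_unfold)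
    also have "\<dots> \<le> (\<Sum>(x,K)\<in>p. (if x \<in> N then \<bar>g (Sup K) - g (Inf K)\<bar> else 0) + e' * (Sup K - Inf K))"
    proof (rule order_trans[OF sum_abs], rule sum_mono)
      fix z assume "z \<in> p"
      then show "\<bar>case z of (x, K) \<Rightarrow> measure lborel K * D x - (g (Sup K) - g (Inf K))\<bar>
          \<le> (case z of (x, K) \<Rightarrow> (if x \<in> N then \<bar>g (Sup K) - g (Inf K)\<bar> else 0) + e' * (Sup K - Inf K))"
        using tm[of "fst z" "snd z"] by (simp add: case_prod_unfold)
    qed
    also have "\<dots> = (\<Sum>(x,K)\<in>q. \<bar>g (Sup K) - g (Inf K)\<bar>) + e' * (b - a)"
    proof -
      have "(\<Sum>(x,K)\<in>p. (if x \<in> N then \<bar>g (Sup K) - g (Inf K)\<bar> else 0)) = (\<Sum>(x,K)\<in>q. \<bar>g (Sup K) - g (Inf K)\<bar>)"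
        unfolding case_prod_unfold
        by (rule sum.mono_neutral_cong_right) (use fin in \<open>auto simp: q_def\<close>)
      then show ?thesis unfolding bsum
        by (simp add: case_prod_unfold sum.distrib sum_distrib_left)
    qed
    also have "\<dots> < e / 2 + e / 2"
    proof -
      have "e' * (b - a) \<le> e' * (b - a + 1)" using e' by simp
      also have "\<dots> = e / 4"
      proof -
        have "e / (4 * c) * c = e / 4" if "c > 0" for c :: real using that by simp
        from this[of "b - a + 1"] show ?thesis using ab by (simp add: e'_def)
      qed
      finally show ?thesis using bad e by linarith
    qed
    finally show "norm ((\<Sum>(x, k)\<in>p. measure lborel k *\<^sub>R D x) - (g b - g a)) < e" by simp
  qed
qed

text \<open>Scalar quantities that are Lipschitz along the curve inherit its absolute continuity, in the form in
which the previous lemma needs it.\<close>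

lemma abs_continuous_Lq_on_functional:
  fixes g :: "real \<Rightarrow> real"
  assumes ac: "abs_continuous_Lq_on q {a..b} v" and C: "0 \<le> C"
    and lip: "\<And>t r. t \<in> {a..b} \<Longrightarrow> r \<in> {a..b} \<Longrightarrow> \<bar>g t - g r\<bar> \<le> C * Lq_dist q (v t) (v r)"
    and \<epsilon>: "\<epsilon> > 0"
  shows "\<exists>\<delta>>0. \<forall>\<D>. \<D> division_of (\<Union>\<D>) \<and> \<Union>\<D> \<subseteq> {a..b} \<and>
        (\<Sum>K\<in>\<D>. Sup K - Inf K) < \<delta> \<longrightarrow> (\<Sum>K\<in>\<D>. \<bar>g (Sup K) - g (Inf K)\<bar>) < \<epsilon>"
proof -
  have "0 < \<epsilon> / (C + 1)" using C \<epsilon> by simp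
  with ac obtain \<delta> where \<delta>: "\<delta> > 0" and *: "\<And>\<D>. \<D> division_of (\<Union>\<D>) \<and> \<Union>\<D> \<subseteq> {a..b} \<and> (\<Sum>K\<in>\<D>. Sup K - Inf K) < \<delta>
        \<Longrightarrow> (\<Sum>K\<in>\<D>. Lq_dist q (v (Sup K)) (v (Inf K))) < \<epsilon> / (C + 1)"
    unfolding abs_continuous_Lq_on_def by blast
  have "(\<Sum>K\<in>\<D>. \<bar>g (Sup K) - g (Inf K)\<bar>) < \<epsilon>"
    if D: "\<D> division_of (\<Union>\<D>) \<and> \<Union>\<D> \<subseteq> {a..b} \<and> (\<Sum>K\<in>\<D>. Sup K - Inf K) < \<delta>" for \<D>
  proof -
    let ?S = "\<Sum>K\<in>\<D>. Lq_dist q (v (Sup K)) (v (Inf K))"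
    have "(\<Sum>K\<in>\<D>. \<bar>g (Sup K) - g (Inf K)\<bar>) \<le> (\<Sum>K\<in>\<D>. C * Lq_dist q (v (Sup K)) (v (Inf K)))"
    proof (rule sum_mono)
      fix K assume K: "K \<in> \<D>"
      obtain c d where cd: "K = {c..d}" using division_ofD(4)[OF conjunct1[OF D] K] by auto
      have "K \<noteq> {}" using division_ofD(3)[OF conjunct1[OF D] K] .
      then have "c \<le> d" using cd by simp
      moreover have "K \<subseteq> {a..b}" using D K by blast
      ultimately have "Sup K \<in> {a..b}" "Inf K \<in> {a..b}" using cd by auto
      then show "\<bar>g (Sup K) - g (Inf K)\<bar> \<le> C * Lq_dist q (v (Sup K)) (v (Inf K))" by (rule lip)
    qed
    also have "\<dots> = C * ?S" by (simp add: sum_distrib_left)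
    also have "\<dots> \<le> (C + 1) * ?S" by (intro mult_right_mono sum_nonneg) (auto simp: Lq_dist_nonneg)
    also have "\<dots> < \<epsilon>" using *[OF D] C by (simp add: pos_less_divide_eq mult.commute)
    finally show ?thesis .
  qed
  with \<delta> show ?thesis by blast
qed

lemma continuous_L2_curve_bounded:
  assumes v: "continuous_Lq_curve 2 v" and a: "0 \<le> a"
  obtains M where "\<And>t. t \<in> {a..b} \<Longrightarrow> Lq_norm 2 (v t) \<le> M"
proof -
  have v2: "v t \<in> Lq_space 2" if "0 \<le> t" for t using v that by (simp add: continuous_Lq_curve_def)
  have "continuous_on {0..} (\<lambda>t. Lq_norm 2 (v t))"
    unfolding continuous_on_def
  proof (intro ballI)
    fix t :: real assume t: "t \<in> {0..}"
    show "((\<lambda>r. Lq_norm 2 (v r)) \<longlongrightarrow> Lq_norm 2 (v t)) (at t within {0..})"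
    proof (rule LIM_zero_cancel, rule Lim_null_comparison)
      show "((\<lambda>r. Lq_dist 2 (v r) (v t)) \<longlongrightarrow> 0) (at t within {0..})"
        using v t by (simp add: continuous_Lq_curve_def)
      show "\<forall>\<^sub>F r in at t within {0..}. norm (Lq_norm 2 (v r) - Lq_norm 2 (v t)) \<le> Lq_dist 2 (v r) (v t)"
        unfolding eventually_at_filter
      proof (intro always_eventually allI impI)
        fix r :: real assume "r \<in> {0..}"
        then have "v r \<in> Lq_space 2" "v t \<in> Lq_space 2" using t v2 by auto
        then show "norm (Lq_norm 2 (v r) - Lq_norm 2 (v t)) \<le> Lq_dist 2 (v r) (v t)"
          using L2_norm_le_dist[of "v r" "v t"] L2_norm_le_dist[of "v t" "v r"] Lq_dist_commute[of 2 "v r" "v t"]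
          by simp
      qed
    qed
  qed
  then have "continuous_on {a..b} (\<lambda>t. Lq_norm 2 (v t))" by (rule continuous_on_subset) (use a in auto)
  then have "bounded ((\<lambda>t. Lq_norm 2 (v t)) ` {a..b})"
    by (intro compact_imp_bounded compact_continuous_image) auto
  then obtain M where "\<forall>y\<in>(\<lambda>t. Lq_norm 2 (v t)) ` {a..b}. norm y \<le> M" by (auto simp: bounded_iff)
  then show thesis using that[of M] by (auto simp: abs_le_iff)
qed


section \<open>The truncated kernel\<close>

lemma nn_integral_lborel_reflect:
  fixes f :: "'a::euclidean_space \<Rightarrow> ennreal"
  assumes [measurable]: "f \<in> borel_measurable borel"
  shows "(\<integral>\<^sup>+y. f (x - y) \<partial>lborel) = (\<integral>\<^sup>+z. f z \<partial>lborel)"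
proof -
  have "(\<integral>\<^sup>+z. f z \<partial>lborel) =
      (\<integral>\<^sup>+z. f z \<partial>density (distr lborel borel (\<lambda>y. x + (-1) *\<^sub>R y)) (\<lambda>_. ennreal (\<bar>-1\<bar> ^ DIM('a))))"
    by (subst lborel_affine[of "-1" x]) auto
  also have "\<dots> = (\<integral>\<^sup>+y. f (x - y) \<partial>lborel)"
    by (simp add: nn_integral_density nn_integral_distr)
  finally show ?thesis by simp
qed

text \<open>The singular kernel times the best bound for the difference of two values of a cutoff
function at points with difference \<open>z\<close>.\<close>

definition scaled_kernel :: "real \<Rightarrow> real \<Rightarrow> 'a::euclidean_space \<Rightarrow> real" where
  "scaled_kernel \<sigma> R z = min 1 (norm z / R) / norm z powr (real DIM('a) + \<sigma>)"

text \<open>The type argument only provides the dimension.\<close>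

definition kernel_const :: "'a::euclidean_space itself \<Rightarrow> real \<Rightarrow> real" where
  "kernel_const _ \<sigma> = unit_ball_vol (real DIM('a)) * (real DIM('a) + \<sigma>) * (1 / (1 - \<sigma>) + 1 / \<sigma>)"

lemma kernel_const_pos: "0 < \<sigma> \<Longrightarrow> \<sigma> < 1 \<Longrightarrow> 0 < kernel_const TYPE('a::euclidean_space) \<sigma>"
  unfolding kernel_const_def by (intro mult_pos_pos add_pos_pos) auto

lemma measurable_scaled_kernel [measurable]: "scaled_kernel \<sigma> R \<in> borel_measurable borel"
  unfolding scaled_kernel_def by measurable

text \<open>A layer cake argument in place of polar coordinates. The radial profile \<open>min 1 (\<rho> / R) \<rho>^(-\<alpha>)\<close>, with
\<open>\<alpha> = N + \<sigma>\<close>, is at most \<open>\<integral> h\<close> over \<open>[\<rho>, \<infinity>)\<close>, where \<open>h(r) = min 1 (r / R) \<alpha> r^(-\<alpha> - 1)\<close>. Exchanging the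
integrals turns the inner one into the volume of a ball, of order \<open>r^N\<close>. There remains an integral of
\<open>r^(-\<sigma>) / R\<close> over \<open>[0, R]\<close>, finite since \<open>\<sigma> < 1\<close>, and one of \<open>r^(-\<sigma> - 1)\<close> over \<open>[R, \<infinity>)\<close>, finite since
\<open>\<sigma> > 0\<close>.\<close>

lemma nn_integral_scaled_kernel:
  fixes \<sigma> R :: real
  assumes \<sigma>: "0 < \<sigma>" "\<sigma> < 1" and R: "R > 0"
  shows "(\<integral>\<^sup>+z. ennreal (scaled_kernel \<sigma> R (z::'a::euclidean_space)) \<partial>lborel)
    \<le> ennreal (kernel_const TYPE('a) \<sigma> * R powr (- \<sigma>))"
proof -
  define \<alpha> where "\<alpha> = real DIM('a) + \<sigma>"
  define V where "V = unit_ball_vol (real DIM('a))"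
  have \<alpha>: "\<alpha> > 0" using \<sigma> by (simp add: \<alpha>_def add_nonneg_pos)
  have V: "V > 0" by (simp add: V_def)
  define h where "h r = (if r > 0 then min 1 (r / R) * (\<alpha> * r powr (- \<alpha> - 1)) else 0)" for r
  have [measurable]: "h \<in> borel_measurable borel" unfolding h_def by measurable
  have h0: "h r \<ge> 0" for r using \<alpha> R by (simp add: h_def)
  have layer: "ennreal (scaled_kernel \<sigma> R z) \<le> (\<integral>\<^sup>+r. ennreal (h r) * indicator {r. norm z \<le> r} r \<partial>lborel)" for z :: 'a
  proof (cases "z = 0")
    case True then show ?thesis by (simp add: scaled_kernel_def)
  next
    case False
    define \<rho> where "\<rho> = norm z"
    have \<rho>: "\<rho> > 0" using False by (simp add: \<rho>_def)
    have hi: "((\<lambda>r. \<alpha> * r powr (- \<alpha> - 1)) has_integral \<rho> powr (- \<alpha>)) {\<rho>..}"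
      using has_integral_mult_right[OF has_integral_powr_to_inf[of "- \<alpha> - 1" \<rho>], of \<alpha>] \<alpha> \<rho> by simp
    have "scaled_kernel \<sigma> R z = min 1 (\<rho> / R) * \<rho> powr (- \<alpha>)"
      unfolding powr_minus_divide by (simp add: scaled_kernel_def \<alpha>_def \<rho>_def)
    then have "ennreal (scaled_kernel \<sigma> R z) = ennreal (min 1 (\<rho> / R)) * ennreal (\<rho> powr (- \<alpha>))"
      using R \<rho> by (simp flip: ennreal_mult')
    also have "\<dots> = ennreal (min 1 (\<rho> / R)) * (\<integral>\<^sup>+r. ennreal (\<alpha> * r powr (- \<alpha> - 1)) * indicator {\<rho>..} r \<partial>lborel)"
      using nn_integral_has_integral_lebesgue'[OF _ hi] \<alpha> by simp
    also have "\<dots> = (\<integral>\<^sup>+r. ennreal (min 1 (\<rho> / R)) * (ennreal (\<alpha> * r powr (- \<alpha> - 1)) * indicator {\<rho>..} r) \<partial>lborel)"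
      by (subst nn_integral_cmult) auto
    also have "\<dots> \<le> (\<integral>\<^sup>+r. ennreal (h r) * indicator {r. norm z \<le> r} r \<partial>lborel)"
    proof (rule nn_integral_mono)
      fix r :: real
      show "ennreal (min 1 (\<rho> / R)) * (ennreal (\<alpha> * r powr (- \<alpha> - 1)) * indicator {\<rho>..} r)
          \<le> ennreal (h r) * indicator {r. norm z \<le> r} r"
      proof (cases "\<rho> \<le> r")
        case True
        have "min 1 (\<rho> / R) \<le> min 1 (r / R)" using True R by (intro min.mono divide_right_mono) auto
        then have "min 1 (\<rho> / R) * (\<alpha> * r powr (- \<alpha> - 1)) \<le> h r"
          using True \<rho> \<alpha> by (auto simp: h_def intro!: mult_right_mono)
        then show ?thesis using True R \<rho> \<alpha>
          by (simp add: \<rho>_def ennreal_leI flip: ennreal_mult')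
      qed (simp add: \<rho>_def)
    qed
    finally show ?thesis .
  qed
  have i1: "((\<lambda>r. \<alpha> * V / R * r powr (- \<sigma>)) has_integral (\<alpha> * V / R * (R powr (1 - \<sigma>) / (1 - \<sigma>)))) {0..R}"
    using has_integral_mult_right[OF has_integral_powr_from_0[of "- \<sigma>" R], of "\<alpha> * V / R"] \<sigma> R
    by (simp add: add.commute)
  have i2: "((\<lambda>r. \<alpha> * V * r powr (- \<sigma> - 1)) has_integral (\<alpha> * V * (R powr (- \<sigma>) / \<sigma>))) {R..}"
    using has_integral_mult_right[OF has_integral_powr_to_inf[of "- \<sigma> - 1" R], of "\<alpha> * V"] \<sigma> R by simp
  have pw: "ennreal (h r) * emeasure lborel (cball (0::'a) r)
      \<le> ennreal (\<alpha> * V / R * r powr (- \<sigma>)) * indicator {0..R} r + ennreal (\<alpha> * V * r powr (- \<sigma> - 1)) * indicator {R..} r" for r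
  proof (cases "r > 0")
    case True
    have rN: "r ^ DIM('a) = r powr real DIM('a)" using True by (simp add: powr_realpow)
    have e: "ennreal (h r) * emeasure lborel (cball (0::'a) r) = ennreal (h r * (V * r ^ DIM('a)))"
      using True V by (simp add: emeasure_cball V_def ennreal_mult h0)
    have m: "h r * (V * r ^ DIM('a)) = min 1 (r / R) * (\<alpha> * V * r powr (- \<sigma> - 1))"
    proof -
      have "r powr (- \<alpha> - 1) * r powr real DIM('a) = r powr (- \<sigma> - 1)"
        by (simp add: \<alpha>_def flip: powr_add)
      then show ?thesis using True by (simp add: h_def rN algebra_simps)
    qed
    show ?thesis
    proof (cases "r \<le> R")
      case True
      have "r powr (- \<sigma> - 1) * r = r powr (- \<sigma>)" using \<open>r > 0\<close> by (simp add: powr_diff)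
      then have "h r * (V * r ^ DIM('a)) = \<alpha> * V / R * r powr (- \<sigma>)"
        using True R unfolding m by (simp add: min_def field_simps)
      then show ?thesis using True \<open>r > 0\<close> unfolding e by simp
    next
      case False
      then show ?thesis using R unfolding e m by simp
    qed
  next
    case False then show ?thesis by (simp add: h_def)
  qed
  have "(\<integral>\<^sup>+z. ennreal (scaled_kernel \<sigma> R (z::'a)) \<partial>lborel)
      \<le> (\<integral>\<^sup>+(z::'a). (\<integral>\<^sup>+r. ennreal (h r) * indicator {r. norm z \<le> r} r \<partial>lborel) \<partial>lborel)"
    by (intro nn_integral_mono layer)
  also have "\<dots> = (\<integral>\<^sup>+r. (\<integral>\<^sup>+(z::'a). ennreal (h r) * indicator {r. norm z \<le> r} r \<partial>lborel) \<partial>lborel)"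
    by (rule lborel_pair.Fubini') (simp add: indicator_def[abs_def] case_prod_unfold)
  also have "\<dots> = (\<integral>\<^sup>+r. ennreal (h r) * emeasure lborel (cball (0::'a) r) \<partial>lborel)"
  proof (rule nn_integral_cong)
    fix r :: real
    have "(\<integral>\<^sup>+(z::'a). ennreal (h r) * indicator {r. norm z \<le> r} r \<partial>lborel)
        = (\<integral>\<^sup>+(z::'a). ennreal (h r) * indicator (cball 0 r) z \<partial>lborel)"
      by (intro nn_integral_cong) (auto simp: indicator_def)
    then show "(\<integral>\<^sup>+(z::'a). ennreal (h r) * indicator {r. norm z \<le> r} r \<partial>lborel)
        = ennreal (h r) * emeasure lborel (cball (0::'a) r)"
      by (simp add: nn_integral_cmult_indicator)
  qed
  also have "\<dots> \<le> (\<integral>\<^sup>+r. ennreal (\<alpha> * V / R * r powr (- \<sigma>)) * indicator {0..R} r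
      + ennreal (\<alpha> * V * r powr (- \<sigma> - 1)) * indicator {R..} r \<partial>lborel)"
    by (intro nn_integral_mono pw)
  also have "\<dots> = (\<integral>\<^sup>+r. ennreal (\<alpha> * V / R * r powr (- \<sigma>)) * indicator {0..R} r \<partial>lborel)
      + (\<integral>\<^sup>+r. ennreal (\<alpha> * V * r powr (- \<sigma> - 1)) * indicator {R..} r \<partial>lborel)"
    by (rule nn_integral_add) auto
  also have "\<dots> = ennreal (\<alpha> * V / R * (R powr (1 - \<sigma>) / (1 - \<sigma>))) + ennreal (\<alpha> * V * (R powr (- \<sigma>) / \<sigma>))"
    using \<alpha> V R by (intro arg_cong2[where f="(+)"] nn_integral_has_integral_lebesgue' i1 i2) auto
  also have "\<dots> = ennreal (kernel_const TYPE('a) \<sigma> * R powr (- \<sigma>))"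
  proof -
    have "R powr (1 - \<sigma>) = R * R powr (- \<sigma>)" using R by (simp add: powr_diff powr_minus_divide)
    then have "\<alpha> * V / R * (R powr (1 - \<sigma>) / (1 - \<sigma>)) = \<alpha> * V * (R powr (- \<sigma>) / (1 - \<sigma>))"
      using R by simp
    then have "\<alpha> * V / R * (R powr (1 - \<sigma>) / (1 - \<sigma>)) + \<alpha> * V * (R powr (- \<sigma>) / \<sigma>)
        = kernel_const TYPE('a) \<sigma> * R powr (- \<sigma>)"
      by (simp add: kernel_const_def \<alpha>_def V_def algebra_simps)
    then show ?thesis using \<alpha> V R \<sigma> by (simp flip: ennreal_plus)
  qed
  finally show ?thesis .
qed


section \<open>Cutoff functions and their variation\<close>

definition cutoff :: "real \<Rightarrow> 'a::euclidean_space \<Rightarrow> real" where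
  "cutoff R x = max 0 (min 1 (2 - norm x / R))"

text \<open>The function \<open>M\<^sub>R\<close> of the introduction.\<close>

definition cutoff_variation :: "real \<Rightarrow> real \<Rightarrow> 'a::euclidean_space \<Rightarrow> ennreal" where
  "cutoff_variation \<sigma> R x =
     (\<integral>\<^sup>+y. ennreal (\<bar>cutoff R x - cutoff R y\<bar> / norm (x - y) powr (real DIM('a) + \<sigma>)) \<partial>lborel)"

lemma measurable_cutoff [measurable]: "cutoff R \<in> borel_measurable borel"
  unfolding cutoff_def by measurable

lemma measurable_cutoff_variation [measurable]: "cutoff_variation \<sigma> R \<in> borel_measurable borel"
  unfolding cutoff_variation_def by measurable

lemma cutoff_nonneg: "0 \<le> cutoff R x" and cutoff_le_1: "cutoff R x \<le> 1"
  by (simp_all add: cutoff_def)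

lemma cutoff_eq_0: "R > 0 \<Longrightarrow> norm x \<ge> 2 * R \<Longrightarrow> cutoff R x = 0"
  by (simp add: cutoff_def field_simps)

lemma cutoff_eq_1: "R > 0 \<Longrightarrow> norm x \<le> R \<Longrightarrow> cutoff R x = 1"
  by (simp add: cutoff_def field_simps)

lemma cutoff_L2:
  assumes "R > 0" shows "(cutoff R :: 'a::euclidean_space \<Rightarrow> real) \<in> Lq_space 2"
proof -
  have "integrable lborel (\<lambda>x::'a. (cutoff R x)\<^sup>2)"
  proof (rule Bochner_Integration.integrable_bound)
    show "integrable lborel (indicator (cball (0::'a) (2 * R)) :: 'a \<Rightarrow> real)"
      using assms by (intro integrable_real_indicator) (auto simp: emeasure_cball)
    have "(cutoff R x)\<^sup>2 \<le> indicator (cball 0 (2 * R)) x" for x :: 'a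
      using cutoff_eq_0[OF assms, of x] cutoff_nonneg[of R x] cutoff_le_1[of R x]
      by (auto simp: indicator_def power_le_one)
    then show "AE x::'a in lborel. norm ((cutoff R x)\<^sup>2) \<le> norm (indicator (cball (0::'a) (2 * R)) x :: real)"
      by (simp add: cutoff_nonneg)
  qed measurable
  then show ?thesis by (simp add: Lq_space_2_iff)
qed

lemma cutoff_integral_tendsto:
  assumes f: "integrable lborel (f :: 'a::euclidean_space \<Rightarrow> real)"
  shows "(\<lambda>n. \<integral>x. cutoff (real (Suc n)) x * f x \<partial>lborel) \<longlonglongrightarrow> (\<integral>x. f x \<partial>lborel)"
proof (rule integral_dominated_convergence)
  show [measurable]: "f \<in> borel_measurable lborel" using f by (rule borel_measurable_integrable)
  show "(\<lambda>x. cutoff (real (Suc n)) x * f x) \<in> borel_measurable lborel" for n by measurable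
  show "integrable lborel (\<lambda>x. \<bar>f x\<bar>)" using f by simp
  show "AE x in lborel. norm (cutoff (real (Suc n)) x * f x) \<le> \<bar>f x\<bar>" for n
    by (auto simp: abs_mult cutoff_nonneg cutoff_le_1 intro!: mult_left_le_one_le)
  show "AE x in lborel. (\<lambda>n. cutoff (real (Suc n)) x * f x) \<longlonglongrightarrow> f x"
  proof (rule AE_I2)
    fix x :: 'a
    obtain m :: nat where m: "norm x \<le> real m" using real_arch_simple by blast
    have "\<forall>\<^sub>F n in sequentially. cutoff (real (Suc n)) x * f x = f x"
      using eventually_ge_at_top[of m]
    proof eventually_elim
      case (elim n)
      then have "cutoff (real (Suc n)) x = 1" using m by (intro cutoff_eq_1) auto
      then show ?case by simp
    qed
    then show "(\<lambda>n. cutoff (real (Suc n)) x * f x) \<longlonglongrightarrow> f x" by (rule tendsto_eventually)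
  qed
qed

lemma cutoff_diff_le:
  assumes "R > 0" shows "\<bar>cutoff R x - cutoff R y\<bar> \<le> min 1 (norm (x - y) / R)"
proof -
  have "\<bar>norm x / R - norm y / R\<bar> \<le> norm (x - y) / R"
    using assms norm_triangle_ineq3[of x y] by (simp add: divide_right_mono flip: diff_divide_distrib)
  then have "\<bar>cutoff R x - cutoff R y\<bar> \<le> norm (x - y) / R"
    unfolding cutoff_def by linarith
  moreover have "\<bar>cutoff R x - cutoff R y\<bar> \<le> 1"
    using cutoff_nonneg[of R x] cutoff_nonneg[of R y] cutoff_le_1[of R x] cutoff_le_1[of R y] by linarith
  ultimately show ?thesis by simp
qed

lemma cutoff_diff_le_scaled_kernel:
  assumes "R > 0"
  shows "\<bar>cutoff R x - cutoff R y\<bar> / norm (x - y) powr (real DIM('a) + \<sigma>)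
    \<le> scaled_kernel \<sigma> R (x - y :: 'a::euclidean_space)"
  unfolding scaled_kernel_def using cutoff_diff_le[OF assms] by (intro divide_right_mono) auto

lemma cutoff_variation_le:
  assumes "0 < \<sigma>" "\<sigma> < 1" "R > 0"
  shows "cutoff_variation \<sigma> R (x::'a::euclidean_space) \<le> ennreal (kernel_const TYPE('a) \<sigma> * R powr (- \<sigma>))"
proof -
  have "cutoff_variation \<sigma> R x \<le> (\<integral>\<^sup>+y. ennreal (scaled_kernel \<sigma> R (x - y)) \<partial>lborel)"
    unfolding cutoff_variation_def
    by (intro nn_integral_mono ennreal_leI cutoff_diff_le_scaled_kernel assms)
  also have "\<dots> = (\<integral>\<^sup>+z. ennreal (scaled_kernel \<sigma> R (z::'a)) \<partial>lborel)"
    by (rule nn_integral_lborel_reflect[of "\<lambda>z. ennreal (scaled_kernel \<sigma> R z)"]) simp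
  also have "\<dots> \<le> ennreal (kernel_const TYPE('a) \<sigma> * R powr (- \<sigma>))"
    by (rule nn_integral_scaled_kernel[OF assms])
  finally show ?thesis .
qed

text \<open>The difference of two cutoff values vanishes unless one of the two points lies in the ball of radius
\<open>2 R\<close>. So the double integral is at most twice the volume of this ball times the integral of the kernel.\<close>

lemma nn_integral_cutoff_variation_le:
  assumes \<sigma>: "0 < \<sigma>" "\<sigma> < 1" and R: "R > 0"
  shows "(\<integral>\<^sup>+x. cutoff_variation \<sigma> R (x::'a::euclidean_space) \<partial>lborel)
    \<le> ennreal (2 * unit_ball_vol (real DIM('a)) * (2 * R) ^ DIM('a) * (kernel_const TYPE('a) \<sigma> * R powr (- \<sigma>)))"
proof -
  define k where "k = (\<lambda>z::'a. ennreal (scaled_kernel \<sigma> R z))"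
  define A where "A = kernel_const TYPE('a) \<sigma> * R powr (- \<sigma>)"
  have [measurable]: "k \<in> borel_measurable borel" unfolding k_def by measurable
  define B where "B = cball (0::'a) (2 * R)"
  have [measurable]: "B \<in> sets borel" by (simp add: B_def)
  have kA: "(\<integral>\<^sup>+y. k (x - y) \<partial>lborel) \<le> ennreal A" for x
    unfolding nn_integral_lborel_reflect[of k, simplified]
    unfolding k_def A_def by (rule nn_integral_scaled_kernel[OF \<sigma> R])
  have kc: "k (x - y) = k (y - x)" for x y by (simp add: k_def scaled_kernel_def norm_minus_commute)
  have half: "(\<integral>\<^sup>+x. (\<integral>\<^sup>+y. indicator B x * k (x - y) \<partial>lborel) \<partial>lborel) \<le> emeasure lborel B * ennreal A"
  proof -
    have "(\<integral>\<^sup>+x. (\<integral>\<^sup>+y. indicator B x * k (x - y) \<partial>lborel) \<partial>lborel)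
        = (\<integral>\<^sup>+x. indicator B x * (\<integral>\<^sup>+y. k (x - y) \<partial>lborel) \<partial>lborel)"
      by (intro nn_integral_cong nn_integral_cmult) measurable
    also have "\<dots> \<le> (\<integral>\<^sup>+x. ennreal A * indicator B x \<partial>lborel)"
      using kA by (intro nn_integral_mono) (auto simp: indicator_def)
    also have "\<dots> = emeasure lborel B * ennreal A"
      by (subst nn_integral_cmult_indicator) (auto simp: mult.commute)
    finally show ?thesis .
  qed
  have pw: "ennreal (\<bar>cutoff R x - cutoff R y\<bar> / norm (x - y) powr (real DIM('a) + \<sigma>))
      \<le> indicator B x * k (x - y) + indicator B y * k (y - x)" for x y
  proof (cases "x \<in> B \<or> y \<in> B")
    case True
    have "ennreal (\<bar>cutoff R x - cutoff R y\<bar> / norm (x - y) powr (real DIM('a) + \<sigma>)) \<le> k (x - y)"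
      unfolding k_def by (intro ennreal_leI cutoff_diff_le_scaled_kernel R)
    also have "\<dots> \<le> indicator B x * k (x - y) + indicator B y * k (y - x)"
      using True kc[of y x] by (auto simp: indicator_def)
    finally show ?thesis .
  next
    case False
    then have "cutoff R x = 0" "cutoff R y = 0" using R by (auto intro!: cutoff_eq_0 simp: B_def)
    then show ?thesis by simp
  qed
  have "(\<integral>\<^sup>+x. cutoff_variation \<sigma> R (x::'a) \<partial>lborel)
      \<le> (\<integral>\<^sup>+x. (\<integral>\<^sup>+y. indicator B x * k (x - y) + indicator B y * k (y - x) \<partial>lborel) \<partial>lborel)"
    unfolding cutoff_variation_def by (intro nn_integral_mono pw)
  also have "\<dots> = (\<integral>\<^sup>+x. (\<integral>\<^sup>+y. indicator B x * k (x - y) \<partial>lborel) + (\<integral>\<^sup>+y. indicator B y * k (y - x) \<partial>lborel) \<partial>lborel)"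
    by (intro nn_integral_cong nn_integral_add) measurable
  also have "\<dots> = (\<integral>\<^sup>+x. (\<integral>\<^sup>+y. indicator B x * k (x - y) \<partial>lborel) \<partial>lborel)
      + (\<integral>\<^sup>+x. (\<integral>\<^sup>+y. indicator B y * k (y - x) \<partial>lborel) \<partial>lborel)"
    by (rule nn_integral_add) measurable
  also have "(\<integral>\<^sup>+x. (\<integral>\<^sup>+y. indicator B y * k (y - x) \<partial>lborel) \<partial>lborel)
      = (\<integral>\<^sup>+x. (\<integral>\<^sup>+y. indicator B x * k (x - y) \<partial>lborel) \<partial>lborel)"
    by (rule lborel_pair.Fubini') measurable
  also have "\<dots> + \<dots> \<le> emeasure lborel B * ennreal A + emeasure lborel B * ennreal A"
    by (intro add_mono half)
  also have "\<dots> = ennreal (2 * unit_ball_vol (real DIM('a)) * (2 * R) ^ DIM('a) * A)"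
  proof -
    have "A > 0" unfolding A_def using \<sigma> R by (simp add: kernel_const_pos)
    then show ?thesis
      using R by (simp add: B_def emeasure_cball flip: ennreal_mult ennreal_plus)
  qed
  finally show ?thesis unfolding A_def .
qed


section \<open>Decay of the boundary term at the critical exponent\<close>

text \<open>A substitute for Hoelder's inequality: for \<open>a \<le> l\<close> the first summand dominates, for \<open>a \<ge> l\<close> the
second. The level \<open>l\<close> is free and will be adapted to the scale \<open>R\<close>.\<close>

lemma powr_le_split:
  fixes a l q :: real
  assumes "0 \<le> a" "0 < l" "0 \<le> q" "q \<le> 1"
  shows "a powr q \<le> l powr q + l powr (q - 1) * a"
proof (cases "a \<le> l")
  case True
  then have "a powr q \<le> l powr q" using assms by (intro powr_mono2) auto
  then show ?thesis using assms by (simp add: add_increasing2)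
next
  case False
  then have "a powr (q - 1) \<le> l powr (q - 1)" using assms by (intro powr_mono2') auto
  then have "a powr (q - 1) * a \<le> l powr (q - 1) * a" using assms by (intro mult_right_mono) auto
  moreover have "a powr (q - 1) * a = a powr q" using False assms by (simp add: powr_diff)
  ultimately show ?thesis by (simp add: add_increasing)
qed

text \<open>The estimate in which the critical exponent enters. At the level \<open>l = \<mu> R^(-N)\<close> the constant part
\<open>l^q\<close>, integrated against a weight of mass \<open>R^(N - \<sigma>)\<close>, carries the power \<open>R^(N (1 - q) - \<sigma>)\<close>, and the linear
part \<open>l^(q - 1) |f|\<close>, against a weight of size \<open>R^(-\<sigma>)\<close>, carries the same power. It equals \<open>1\<close>.\<close>

lemma nn_integral_powr_cutoff_variation_le:
  fixes f :: "'a::euclidean_space \<Rightarrow> real"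
  assumes \<sigma>: "0 < \<sigma>" "\<sigma> < 1" and R: "R > 0" and q: "0 \<le> q" "q \<le> 1"
    and crit: "real DIM('a) * (1 - q) = \<sigma>" and \<mu>: "\<mu> > 0"
    and [measurable]: "f \<in> borel_measurable borel" "S \<in> sets borel"
  shows "(\<integral>\<^sup>+x. ennreal (\<bar>f x\<bar> powr q) * cutoff_variation \<sigma> R x * indicator S x \<partial>lborel)
    \<le> ennreal (kernel_const TYPE('a) \<sigma>) * (ennreal (2 * unit_ball_vol (real DIM('a)) * 2 ^ DIM('a) * \<mu> powr q)
       + ennreal (\<mu> powr (q - 1)) * (\<integral>\<^sup>+x. ennreal \<bar>f x\<bar> * indicator S x \<partial>lborel))"
proof -
  \<comment> \<open>the size of a function of mass \<open>\<mu>\<close> spread over a ball of radius \<open>R\<close>\<close>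
  define l where "l = \<mu> * R powr (- real DIM('a))"
  have l: "l > 0" using \<mu> R by (simp add: l_def)
  define K where "K = kernel_const TYPE('a) \<sigma>"
  have K: "K > 0" unfolding K_def by (rule kernel_const_pos[OF \<sigma>])
  define c where "c = 2 * unit_ball_vol (real DIM('a)) * 2 ^ DIM('a)"
  have c: "c \<ge> 0" by (simp add: c_def)
  have l1: "l powr q * (2 * unit_ball_vol (real DIM('a)) * (2 * R) ^ DIM('a) * (K * R powr (- \<sigma>))) = K * (c * \<mu> powr q)"
  proof -
    have "R powr (- real DIM('a) * q) * R ^ DIM('a) * R powr (- \<sigma>) = R powr (real DIM('a) * (1 - q) - \<sigma>)"
      using R by (simp add: powr_realpow[symmetric] algebra_simps flip: powr_add)
    also have "\<dots> = 1" using crit R by simp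
    finally have *: "R powr (- real DIM('a) * q) * R ^ DIM('a) * R powr (- \<sigma>) = 1" .
    have "l powr q = \<mu> powr q * R powr (- real DIM('a) * q)"
      using \<mu> R by (simp add: l_def powr_mult powr_powr)
    then have "l powr q * (2 * unit_ball_vol (real DIM('a)) * (2 * R) ^ DIM('a) * (K * R powr (- \<sigma>)))
       = K * (c * \<mu> powr q) * (R powr (- real DIM('a) * q) * R ^ DIM('a) * R powr (- \<sigma>))"
      by (simp add: c_def power_mult_distrib)
    then show ?thesis unfolding * by simp
  qed
  have l2: "l powr (q - 1) * (K * R powr (- \<sigma>)) = K * \<mu> powr (q - 1)"
  proof -
    have "R powr (- real DIM('a) * (q - 1)) * R powr (- \<sigma>) = R powr (real DIM('a) * (1 - q) - \<sigma>)"
      by (simp add: algebra_simps flip: powr_add)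
    also have "\<dots> = 1" using crit R by simp
    finally have *: "R powr (- real DIM('a) * (q - 1)) * R powr (- \<sigma>) = 1" .
    have "l powr (q - 1) = \<mu> powr (q - 1) * R powr (- real DIM('a) * (q - 1))"
      using \<mu> R by (simp add: l_def powr_mult powr_powr)
    then have "l powr (q - 1) * (K * R powr (- \<sigma>))
       = K * \<mu> powr (q - 1) * (R powr (- real DIM('a) * (q - 1)) * R powr (- \<sigma>))" by simp
    then show ?thesis unfolding * by simp
  qed
  let ?M = "cutoff_variation \<sigma> R :: 'a \<Rightarrow> ennreal"
  have "(\<integral>\<^sup>+x. ennreal (\<bar>f x\<bar> powr q) * ?M x * indicator S x \<partial>lborel)
     \<le> (\<integral>\<^sup>+x. ennreal (l powr q) * ?M x + ennreal (l powr (q - 1) * (K * R powr (- \<sigma>))) * (ennreal \<bar>f x\<bar> * indicator S x) \<partial>lborel)"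
  proof (rule nn_integral_mono)
    fix x
    have "ennreal (\<bar>f x\<bar> powr q) * ?M x \<le> (ennreal (l powr q) + ennreal (l powr (q - 1)) * ennreal \<bar>f x\<bar>) * ?M x"
      using powr_le_split[of "\<bar>f x\<bar>" l q] l q
      by (intro mult_right_mono) (simp_all add: ennreal_leI flip: ennreal_mult ennreal_plus)
    also have "\<dots> \<le> ennreal (l powr q) * ?M x + ennreal (l powr (q - 1)) * ennreal \<bar>f x\<bar> * ennreal (K * R powr (- \<sigma>))"
      unfolding distrib_right using cutoff_variation_le[OF \<sigma> R, of x] unfolding K_def
      by (intro add_mono mult_left_mono) auto
    also have "\<dots> = ennreal (l powr q) * ?M x + ennreal (l powr (q - 1) * (K * R powr (- \<sigma>))) * ennreal \<bar>f x\<bar>"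
      using K by (simp add: ennreal_mult mult_ac)
    finally show "ennreal (\<bar>f x\<bar> powr q) * ?M x * indicator S x
       \<le> ennreal (l powr q) * ?M x + ennreal (l powr (q - 1) * (K * R powr (- \<sigma>))) * (ennreal \<bar>f x\<bar> * indicator S x)"
      by (auto simp: indicator_def)
  qed
  also have "\<dots> = ennreal (l powr q) * (\<integral>\<^sup>+x. ?M x \<partial>lborel)
      + ennreal (l powr (q - 1) * (K * R powr (- \<sigma>))) * (\<integral>\<^sup>+x. ennreal \<bar>f x\<bar> * indicator S x \<partial>lborel)"
    by (simp add: nn_integral_add nn_integral_cmult)
  also have "\<dots> \<le> ennreal (l powr q) * ennreal (2 * unit_ball_vol (real DIM('a)) * (2 * R) ^ DIM('a) * (K * R powr (- \<sigma>)))
      + ennreal (l powr (q - 1) * (K * R powr (- \<sigma>))) * (\<integral>\<^sup>+x. ennreal \<bar>f x\<bar> * indicator S x \<partial>lborel)"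
    unfolding K_def by (intro add_mono mult_left_mono nn_integral_cutoff_variation_le \<sigma> R) auto
  also have "ennreal (l powr q) * ennreal (2 * unit_ball_vol (real DIM('a)) * (2 * R) ^ DIM('a) * (K * R powr (- \<sigma>)))
      = ennreal (K * (c * \<mu> powr q))"
    by (subst ennreal_mult'[symmetric]) (simp_all only: l1 powr_ge_zero)
  also have "ennreal (l powr (q - 1) * (K * R powr (- \<sigma>))) = ennreal (K * \<mu> powr (q - 1))" by (simp only: l2)
  also have "ennreal (K * (c * \<mu> powr q)) + ennreal (K * \<mu> powr (q - 1)) * (\<integral>\<^sup>+x. ennreal \<bar>f x\<bar> * indicator S x \<partial>lborel)
     = ennreal K * (ennreal (c * \<mu> powr q) + ennreal (\<mu> powr (q - 1)) * (\<integral>\<^sup>+x. ennreal \<bar>f x\<bar> * indicator S x \<partial>lborel))"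
    using K c by (simp add: ennreal_mult distrib_left mult.assoc)
  finally show ?thesis unfolding K_def c_def .
qed

lemma powr_cutoff_variation_bounded:
  fixes f :: "'a::euclidean_space \<Rightarrow> real"
  assumes \<sigma>: "0 < \<sigma>" "\<sigma> < 1" and R: "R > 0" and q: "0 \<le> q" "q \<le> 1"
    and crit: "real DIM('a) * (1 - q) = \<sigma>"
    and [measurable]: "f \<in> borel_measurable borel"
  shows "(\<integral>\<^sup>+x. ennreal (\<bar>f x\<bar> powr q) * cutoff_variation \<sigma> R x \<partial>lborel)
    \<le> ennreal (kernel_const TYPE('a) \<sigma>) *
       (ennreal (2 * unit_ball_vol (real DIM('a)) * 2 ^ DIM('a)) + (\<integral>\<^sup>+x. ennreal \<bar>f x\<bar> \<partial>lborel))"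
  using nn_integral_powr_cutoff_variation_le[OF \<sigma> R q crit, of 1 f UNIV] by simp

text \<open>The scale-invariant estimate alone only gives boundedness. Decay comes from splitting space at a fixed
ball \<open>B\<close>. Outside \<open>B\<close> the estimate is used with \<open>\<mu>\<close> so small that its first term is at most \<open>\<epsilon> / 3\<close>, and
then with \<open>B\<close> so large that the second term is. Inside \<open>B\<close> the integral of \<open>|f|^q \<le> 1 + |f|\<close> is finite and the
weight is of order \<open>R^(-\<sigma>)\<close>.\<close>

lemma powr_cutoff_variation_vanishes:
  fixes f :: "'a::euclidean_space \<Rightarrow> real"
  assumes \<sigma>: "0 < \<sigma>" "\<sigma> < 1" and q: "0 < q" "q \<le> 1"
    and crit: "real DIM('a) * (1 - q) = \<sigma>"
    and f: "integrable lborel f" and \<epsilon>: "\<epsilon> > 0"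
  shows "\<forall>\<^sub>F R in at_top. (\<integral>\<^sup>+x. ennreal (\<bar>f x\<bar> powr q) * cutoff_variation \<sigma> R x \<partial>lborel) \<le> ennreal \<epsilon>"
proof -
  have [measurable]: "f \<in> borel_measurable borel" using f by (simp add: borel_measurable_integrable)
  define K where "K = kernel_const TYPE('a) \<sigma>"
  have K: "K > 0" unfolding K_def by (rule kernel_const_pos[OF \<sigma>])
  define c where "c = 2 * unit_ball_vol (real DIM('a)) * 2 ^ DIM('a)"
  have c: "c > 0" by (simp add: c_def)
  define \<mu> where "\<mu> = (\<epsilon> / (3 * K * c)) powr (1 / q)"
  have \<mu>: "\<mu> > 0" using \<epsilon> K c by (simp add: \<mu>_def)
  have \<mu>q: "K * (c * \<mu> powr q) = \<epsilon> / 3" using \<epsilon> K c q by (simp add: \<mu>_def powr_powr)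
  define tail where "tail n = (\<integral>x. \<bar>f x\<bar> * indicator (- cball 0 (real n)) x \<partial>lborel)" for n :: nat
  have "tail \<longlonglongrightarrow> (\<integral>(x::'a). 0 \<partial>lborel)"
    unfolding tail_def
  proof (rule integral_dominated_convergence)
    show "integrable lborel (\<lambda>x. \<bar>f x\<bar>)" using f by simp
    show "AE x in lborel. (\<lambda>n. \<bar>f x\<bar> * indicator (- cball 0 (real n)) x) \<longlonglongrightarrow> 0"
    proof (rule AE_I2)
      fix x :: 'a
      obtain m :: nat where m: "norm x \<le> real m" using real_arch_simple by blast
      have "\<forall>\<^sub>F n in sequentially. \<bar>f x\<bar> * indicator (- cball 0 (real n)) x = 0"
        using eventually_ge_at_top[of m] by eventually_elim (use m in auto)
      then show "(\<lambda>n. \<bar>f x\<bar> * indicator (- cball 0 (real n)) x) \<longlonglongrightarrow> 0"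
        by (rule tendsto_eventually)
    qed
  qed (auto simp: indicator_def)
  then have "(\<lambda>n. K * (\<mu> powr (q - 1) * tail n)) \<longlonglongrightarrow> K * (\<mu> powr (q - 1) * 0)"
    by (intro tendsto_intros) simp
  then have "\<forall>\<^sub>F n in sequentially. K * (\<mu> powr (q - 1) * tail n) < \<epsilon> / 3"
    using \<epsilon> by (intro order_tendstoD) auto
  then obtain n where n: "K * (\<mu> powr (q - 1) * tail n) < \<epsilon> / 3"
    by (auto simp: eventually_sequentially)
  define B where "B = cball (0::'a) (real n)"
  have [measurable]: "B \<in> sets borel" by (simp add: B_def)
  have ti: "(\<integral>\<^sup>+x. ennreal \<bar>f x\<bar> * indicator (- B) x \<partial>lborel) = ennreal (tail n)"
  proof -
    have "(\<integral>\<^sup>+x. ennreal (\<bar>f x\<bar> * indicator (- B) x) \<partial>lborel) = ennreal (tail n)"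
      unfolding tail_def B_def
      by (intro nn_integral_eq_integral integrable_real_mult_indicator) (use f in auto)
    then show ?thesis by (simp add: ennreal_mult' ennreal_indicator)
  qed
  have out: "(\<integral>\<^sup>+x. ennreal (\<bar>f x\<bar> powr q) * cutoff_variation \<sigma> R x * indicator (- B) x \<partial>lborel) \<le> ennreal (2 * \<epsilon> / 3)"
    if R: "R > 0" for R
  proof -
    have t0: "0 \<le> tail n" by (simp add: tail_def)
    have "(\<integral>\<^sup>+x. ennreal (\<bar>f x\<bar> powr q) * cutoff_variation \<sigma> R x * indicator (- B) x \<partial>lborel)
      \<le> ennreal K * (ennreal (c * \<mu> powr q) + ennreal (\<mu> powr (q - 1)) * ennreal (tail n))"
      using nn_integral_powr_cutoff_variation_le[OF \<sigma> R _ q(2) crit \<mu>, of f "- B"] q(1)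
      unfolding ti K_def c_def by simp
    also have "\<dots> = ennreal (K * (c * \<mu> powr q) + K * (\<mu> powr (q - 1) * tail n))"
      using K c t0 by (simp add: distrib_left flip: ennreal_mult ennreal_plus)
    also have "\<dots> \<le> ennreal (2 * \<epsilon> / 3)" unfolding \<mu>q using n by (intro ennreal_leI) simp
    finally show ?thesis .
  qed
  define m where "m = (\<integral>x. indicator B x + \<bar>f x\<bar> \<partial>lborel)"
  have iB: "integrable lborel (\<lambda>x. indicator B x + \<bar>f x\<bar>)"
    using f by (intro Bochner_Integration.integrable_add integrable_real_indicator)
      (auto simp: B_def emeasure_cball)
  have inside: "(\<integral>\<^sup>+x. ennreal (\<bar>f x\<bar> powr q) * cutoff_variation \<sigma> R x * indicator B x \<partial>lborel)
      \<le> ennreal (K * R powr (- \<sigma>) * m)" if R: "R > 0" for R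
  proof -
    have "(\<integral>\<^sup>+x. ennreal (\<bar>f x\<bar> powr q) * cutoff_variation \<sigma> R x * indicator B x \<partial>lborel)
       \<le> (\<integral>\<^sup>+x. ennreal (K * R powr (- \<sigma>)) * ennreal (indicator B x + \<bar>f x\<bar>) \<partial>lborel)"
    proof (rule nn_integral_mono)
      fix x
      have "\<bar>f x\<bar> powr q \<le> 1 + \<bar>f x\<bar>" using powr_le_split[of "\<bar>f x\<bar>" 1 q] q by simp
      then have "ennreal (\<bar>f x\<bar> powr q) * cutoff_variation \<sigma> R x \<le> ennreal (1 + \<bar>f x\<bar>) * ennreal (K * R powr (- \<sigma>))"
        using cutoff_variation_le[OF \<sigma> R, of x] unfolding K_def by (intro mult_mono ennreal_leI) auto
      then show "ennreal (\<bar>f x\<bar> powr q) * cutoff_variation \<sigma> R x * indicator B x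
          \<le> ennreal (K * R powr (- \<sigma>)) * ennreal (indicator B x + \<bar>f x\<bar>)"
        by (auto simp: indicator_def mult.commute)
    qed
    also have "\<dots> = ennreal (K * R powr (- \<sigma>)) * ennreal m"
    proof -
      have "(\<integral>\<^sup>+x. ennreal (indicator B x + \<bar>f x\<bar>) \<partial>lborel) = ennreal m"
        unfolding m_def by (rule nn_integral_eq_integral[OF iB]) simp
      then show ?thesis by (subst nn_integral_cmult) simp_all
    qed
    also have "\<dots> = ennreal (K * R powr (- \<sigma>) * m)"
      by (rule ennreal_mult''[symmetric]) (simp add: m_def)
    finally show ?thesis .
  qed
  have "((\<lambda>R. K * R powr (- \<sigma>) * m) \<longlongrightarrow> K * 0 * m) at_top"
    by (intro tendsto_intros tendsto_neg_powr filterlim_ident) (use \<sigma> in auto)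
  then have "\<forall>\<^sub>F R in at_top. K * R powr (- \<sigma>) * m < \<epsilon> / 3"
    using \<epsilon> by (intro order_tendstoD) auto
  then show ?thesis using eventually_gt_at_top[of 0]
  proof eventually_elim
    case (elim R)
    have "(\<integral>\<^sup>+x. ennreal (\<bar>f x\<bar> powr q) * cutoff_variation \<sigma> R x \<partial>lborel)
      = (\<integral>\<^sup>+x. ennreal (\<bar>f x\<bar> powr q) * cutoff_variation \<sigma> R x * indicator B x
          + ennreal (\<bar>f x\<bar> powr q) * cutoff_variation \<sigma> R x * indicator (- B) x \<partial>lborel)"
      by (intro nn_integral_cong) (auto simp: indicator_def)
    also have "\<dots> = (\<integral>\<^sup>+x. ennreal (\<bar>f x\<bar> powr q) * cutoff_variation \<sigma> R x * indicator B x \<partial>lborel)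
       + (\<integral>\<^sup>+x. ennreal (\<bar>f x\<bar> powr q) * cutoff_variation \<sigma> R x * indicator (- B) x \<partial>lborel)"
      by (intro nn_integral_add) auto
    also have "\<dots> \<le> ennreal (\<epsilon> / 3) + ennreal (2 * \<epsilon> / 3)"
      using elim by (intro add_mono out order_trans[OF inside] ennreal_leI) auto
    also have "\<dots> = ennreal \<epsilon>" using \<epsilon> by (simp flip: ennreal_plus)
    finally show ?case .
  qed
qed


section \<open>Subgradients of the energy tested with cutoff functions\<close>

lemma powr_subadditive:
  fixes a b q :: real
  assumes "0 \<le> a" "0 \<le> b" "0 < q" "q \<le> 1"
  shows "(a + b) powr q \<le> a powr q + b powr q"
proof (cases "a = 0 \<or> b = 0")
  case False
  then have pos: "a > 0" "b > 0" using assms by auto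
  have "(a + b) powr q = a * (a + b) powr (q - 1) + b * (a + b) powr (q - 1)"
    using powr_mult_base[of "a + b" "q - 1"] pos by (simp add: distrib_right)
  also have "\<dots> \<le> a * a powr (q - 1) + b * b powr (q - 1)"
    using pos assms by (intro add_mono mult_left_mono powr_mono2') auto
  also have "\<dots> = a powr q + b powr q" using pos by (simp add: powr_diff)
  finally show ?thesis .
qed (use assms in auto)

text \<open>The graph of the convex function \<open>x \<mapsto> x^p\<close> lies above its tangent at \<open>s\<close>; after division by \<open>s^p\<close>
this is Young's inequality for \<open>u / s\<close> and \<open>1\<close>.\<close>

lemma powr_tangent_le:
  fixes u s p :: real
  assumes "0 \<le> u" "0 < s" "1 < p"
  shows "s powr p - u powr p \<le> p * (s - u) * s powr (p - 1)"
proof -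
  define r where "r = u / s"
  have r: "0 \<le> r" using assms by (simp add: r_def)
  have "r \<le> r powr p / p + 1 - 1 / p"
  proof (cases "r = 0")
    case False
    then have "(r powr p) powr (1 / p) * 1 powr (1 - 1 / p) \<le> 1 / p * r powr p + (1 - 1 / p) * 1"
      using assms r by (intro Youngs_inequality_0) auto
    then show ?thesis using assms r by (simp add: powr_powr)
  qed (use assms in simp)
  then have "p * r \<le> p * (r powr p / p + 1 - 1 / p)" using assms by (intro mult_left_mono) auto
  also have "\<dots> = r powr p + p - 1" using assms by (simp add: algebra_simps)
  finally have "s powr p * (1 - r powr p) \<le> s powr p * (p * (1 - r))"
    by (intro mult_left_mono) (auto simp: algebra_simps)
  moreover have "s powr p * r powr p = u powr p"
    using assms r by (simp add: r_def powr_divide)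
  moreover have "s powr p * (p * (1 - r)) = p * (s - u) * s powr (p - 1)"
    using assms by (simp add: r_def powr_diff field_simps)
  ultimately show ?thesis by (simp add: algebra_simps)
qed

text \<open>Growth of the energy density under a perturbation \<open>h\<close>. The term linear in \<open>h\<close> has the expected
coefficient \<open>p |a|^(p - 1)\<close>, and the error \<open>p |h|^p\<close> is of higher order as \<open>p > 1\<close>.\<close>

lemma powr_add_le:
  fixes a h p :: real
  assumes p: "1 < p" "p \<le> 2"
  shows "\<bar>a + h\<bar> powr p \<le> \<bar>a\<bar> powr p + p * \<bar>h\<bar> * (\<bar>a\<bar> powr (p - 1) + \<bar>h\<bar> powr (p - 1))"
proof (cases "\<bar>a\<bar> + \<bar>h\<bar> = 0")
  case False
  define s where "s = \<bar>a\<bar> + \<bar>h\<bar>"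
  have s: "s > 0" using False by (simp add: s_def)
  have "\<bar>a + h\<bar> powr p \<le> s powr p" using p by (intro powr_mono2) (auto simp: s_def)
  also have "\<dots> \<le> \<bar>a\<bar> powr p + p * \<bar>h\<bar> * s powr (p - 1)"
    using powr_tangent_le[of "\<bar>a\<bar>" s p] s p by (simp add: s_def)
  also have "\<dots> \<le> \<bar>a\<bar> powr p + p * \<bar>h\<bar> * (\<bar>a\<bar> powr (p - 1) + \<bar>h\<bar> powr (p - 1))"
    unfolding s_def using p by (intro add_left_mono mult_left_mono powr_subadditive) auto
  finally show ?thesis .
qed (auto simp: add_nonneg_eq_0_iff)

text \<open>The bound for the first variation that the principal value integral suggests, obtained without
differentiating the energy \<open>F\<close>. The subgradient inequality at \<open>f + e \<phi>\<^sub>R\<close>, for both signs of \<open>e\<close>, compares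
\<open>e \<integral> \<xi> \<phi>\<^sub>R\<close> with the growth of \<open>F\<close>, which is at most \<open>|e| B + |e|^p C\<close>. Here
\<open>B = \<integral>\<integral> |f x - f y|^(p - 1) |\<phi>\<^sub>R x - \<phi>\<^sub>R y| / |x - y|^(N + s p) dx dy\<close> and \<open>C\<close> is finite. Divide by \<open>|e|\<close>
and let \<open>e \<rightarrow> 0\<close>. Finally \<open>B\<close> is at most twice the weighted integral, by subadditivity of \<open>x \<mapsto> x^(p - 1)\<close> and
symmetry in \<open>x\<close> and \<open>y\<close>.\<close>

lemma subgradient_cutoff_le:
  fixes f \<xi> :: "'a::euclidean_space \<Rightarrow> real"
  assumes p: "1 < p" "p \<le> 2" and sp: "0 < s * p" "s * p < 1" and R: "R > 0"
    and sub: "\<xi> \<in> L2_subdifferential (frac_p_energy s p) f"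
  shows "ennreal \<bar>\<integral>x. \<xi> x * cutoff R x \<partial>lborel\<bar>
    \<le> 2 * (\<integral>\<^sup>+x. ennreal (\<bar>f x\<bar> powr (p - 1)) * cutoff_variation (s * p) R x \<partial>lborel)"
proof -
  let ?P = "lborel \<Otimes>\<^sub>M lborel :: ('a \<times> 'a) measure"
  define \<alpha> where "\<alpha> = real DIM('a) + s * p"
  have f2: "f \<in> Lq_space 2" and Ff: "frac_p_energy s p f < \<infinity>"
    and subg: "\<And>g. g \<in> Lq_space 2 \<Longrightarrow>
       frac_p_energy s p f + ereal (\<integral>x. \<xi> x * (g x - f x) \<partial>lborel) \<le> frac_p_energy s p g"
    using sub by (auto simp: L2_subdifferential_def)
  have [measurable]: "f \<in> borel_measurable borel" using f2 by (rule measurable_Lq_space)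
  define I where "I h = (\<integral>\<^sup>+z. ennreal (\<bar>h (fst z) - h (snd z)\<bar> powr p / norm (fst z - snd z) powr \<alpha>) \<partial>?P)" for h :: "'a \<Rightarrow> real"
  have F: "frac_p_energy s p h = enn2ereal (ennreal (1 / p) * I h)" for h :: "'a \<Rightarrow> real"
    unfolding frac_p_energy_def I_def \<alpha>_def by (simp add: case_prod_unfold)
  define B where "B = (\<integral>\<^sup>+z. ennreal (\<bar>f (fst z) - f (snd z)\<bar> powr (p - 1) * (\<bar>cutoff R (fst z) - cutoff R (snd z)\<bar> / norm (fst z - snd z) powr \<alpha>)) \<partial>?P)"
  define C where "C = (\<integral>\<^sup>+z. ennreal (\<bar>cutoff R (fst z) - cutoff R (snd z)\<bar> / norm (fst z - snd z :: 'a) powr \<alpha>) \<partial>?P)"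
  have C: "C < \<infinity>"
  proof -
    have "C = (\<integral>\<^sup>+x. cutoff_variation (s * p) R (x::'a) \<partial>lborel)"
      unfolding C_def cutoff_variation_def \<alpha>_def
      by (subst lborel.nn_integral_fst[symmetric]) auto
    also have "\<dots> < \<infinity>"
      using nn_integral_cutoff_variation_le[OF sp R, where 'a='a] by (rule le_less_trans) simp
    finally show ?thesis .
  qed
  have B: "B \<le> 2 * (\<integral>\<^sup>+x. ennreal (\<bar>f x\<bar> powr (p - 1)) * cutoff_variation (s * p) R x \<partial>lborel)"
  proof -
    define k where "k x y = ennreal (\<bar>cutoff R x - cutoff R y\<bar> / norm (x - y) powr \<alpha>)" for x y :: 'a
    have [measurable]: "case_prod k \<in> borel_measurable (borel \<Otimes>\<^sub>M borel)"
      unfolding k_def by (simp add: case_prod_unfold)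
    have ksym: "k x y = k y x" for x y by (simp add: k_def norm_minus_commute abs_minus_commute)
    have "B \<le> (\<integral>\<^sup>+z. ennreal (\<bar>f (fst z)\<bar> powr (p - 1)) * k (fst z) (snd z)
        + ennreal (\<bar>f (snd z)\<bar> powr (p - 1)) * k (snd z) (fst z) \<partial>?P)"
      unfolding B_def
    proof (rule nn_integral_mono)
      fix z :: "'a \<times> 'a"
      obtain x y where z: "z = (x, y)" by (cases z)
      have "\<bar>f x - f y\<bar> powr (p - 1) \<le> (\<bar>f x\<bar> + \<bar>f y\<bar>) powr (p - 1)"
        using p by (intro powr_mono2) auto
      also have "\<dots> \<le> \<bar>f x\<bar> powr (p - 1) + \<bar>f y\<bar> powr (p - 1)"
        using p by (intro powr_subadditive) auto
      finally have "ennreal (\<bar>f x - f y\<bar> powr (p - 1)) * k x y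
          \<le> (ennreal (\<bar>f x\<bar> powr (p - 1)) + ennreal (\<bar>f y\<bar> powr (p - 1))) * k x y"
        by (intro mult_right_mono) (auto simp: ennreal_leI simp flip: ennreal_plus)
      then show "ennreal (\<bar>f (fst z) - f (snd z)\<bar> powr (p - 1) * (\<bar>cutoff R (fst z) - cutoff R (snd z)\<bar> / norm (fst z - snd z) powr \<alpha>))
         \<le> ennreal (\<bar>f (fst z)\<bar> powr (p - 1)) * k (fst z) (snd z) + ennreal (\<bar>f (snd z)\<bar> powr (p - 1)) * k (snd z) (fst z)"
        unfolding z fst_conv snd_conv ksym[of y x] distrib_right
        by (subst ennreal_mult) (simp_all add: k_def)
    qed
    also have "\<dots> = (\<integral>\<^sup>+z. ennreal (\<bar>f (fst z)\<bar> powr (p - 1)) * k (fst z) (snd z) \<partial>?P)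
        + (\<integral>\<^sup>+z. ennreal (\<bar>f (snd z)\<bar> powr (p - 1)) * k (snd z) (fst z) \<partial>?P)"
      by (rule nn_integral_add) auto
    also have "(\<integral>\<^sup>+z. ennreal (\<bar>f (fst z)\<bar> powr (p - 1)) * k (fst z) (snd z) \<partial>?P)
       = (\<integral>\<^sup>+x. (\<integral>\<^sup>+y. ennreal (\<bar>f x\<bar> powr (p - 1)) * k x y \<partial>lborel) \<partial>lborel)"
      by (subst lborel.nn_integral_fst[symmetric]) auto
    also have "(\<integral>\<^sup>+z. ennreal (\<bar>f (snd z)\<bar> powr (p - 1)) * k (snd z) (fst z) \<partial>?P)
       = (\<integral>\<^sup>+x. (\<integral>\<^sup>+y. ennreal (\<bar>f x\<bar> powr (p - 1)) * k x y \<partial>lborel) \<partial>lborel)"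
      by (subst lborel_pair.nn_integral_snd[symmetric]) auto
    also have "(\<integral>\<^sup>+x. (\<integral>\<^sup>+y. ennreal (\<bar>f x\<bar> powr (p - 1)) * k x y \<partial>lborel) \<partial>lborel)
       = (\<integral>\<^sup>+x. ennreal (\<bar>f x\<bar> powr (p - 1)) * cutoff_variation (s * p) R x \<partial>lborel)"
      unfolding cutoff_variation_def \<alpha>_def[symmetric] k_def
      by (intro nn_integral_cong nn_integral_cmult) measurable
    finally show ?thesis by (simp add: mult_2)
  qed
  have ennreal_lin: "ennreal (w + (u * X + v * Y)) = ennreal w + (ennreal u * ennreal X + ennreal v * ennreal Y)"
    if "0 \<le> w" "0 \<le> u" "0 \<le> X" "0 \<le> v" "0 \<le> Y" for w u X v Y
    using that by (simp add: ennreal_mult)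
  have growth: "I (\<lambda>x. f x + e * cutoff R x) \<le> I f + (ennreal (p * \<bar>e\<bar>) * B + ennreal (p * \<bar>e\<bar> powr p) * C)" for e
  proof -
    have "I (\<lambda>x. f x + e * cutoff R x) \<le>
      (\<integral>\<^sup>+z. ennreal (\<bar>f (fst z) - f (snd z)\<bar> powr p / norm (fst z - snd z) powr \<alpha>)
        + (ennreal (p * \<bar>e\<bar>) * ennreal (\<bar>f (fst z) - f (snd z)\<bar> powr (p - 1) * (\<bar>cutoff R (fst z) - cutoff R (snd z)\<bar> / norm (fst z - snd z) powr \<alpha>))
        + ennreal (p * \<bar>e\<bar> powr p) * ennreal (\<bar>cutoff R (fst z) - cutoff R (snd z)\<bar> / norm (fst z - snd z) powr \<alpha>)) \<partial>?P)"
      unfolding I_def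
    proof (rule nn_integral_mono)
      fix z :: "'a \<times> 'a"
      define a where "a = f (fst z) - f (snd z)"
      define b where "b = cutoff R (fst z) - cutoff R (snd z)"
      define D where "D = norm (fst z - snd z) powr \<alpha>"
      have b1: "\<bar>b\<bar> \<le> 1" using cutoff_diff_le[OF R, of "fst z" "snd z"] by (simp add: b_def)
      have eq: "f (fst z) + e * cutoff R (fst z) - (f (snd z) + e * cutoff R (snd z)) = a + e * b"
        by (simp add: a_def b_def algebra_simps)
      \<comment> \<open>As \<open>|b| \<le> 1\<close>, the first power of \<open>|b|\<close> controls the error, so \<open>C\<close>, the integral of \<open>M\<^sub>R\<close>, suffices.\<close>
      have bp: "\<bar>b\<bar> * \<bar>b\<bar> powr (p - 1) \<le> \<bar>b\<bar>"
        using powr_le1[of "p - 1" "\<bar>b\<bar>"] b1 p by (intro mult_left_le) auto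
      have ee: "\<bar>e\<bar> * \<bar>e\<bar> powr (p - 1) = \<bar>e\<bar> powr p" using powr_mult_base[of "\<bar>e\<bar>" "p - 1"] by simp
      have "\<bar>a + e * b\<bar> powr p \<le> \<bar>a\<bar> powr p + p * \<bar>e * b\<bar> * (\<bar>a\<bar> powr (p - 1) + \<bar>e * b\<bar> powr (p - 1))"
        by (rule powr_add_le[OF p])
      also have "\<dots> = \<bar>a\<bar> powr p + p * \<bar>e\<bar> * (\<bar>a\<bar> powr (p - 1) * \<bar>b\<bar>)
          + p * (\<bar>e\<bar> * \<bar>e\<bar> powr (p - 1)) * (\<bar>b\<bar> * \<bar>b\<bar> powr (p - 1))"
        by (simp add: abs_mult powr_mult algebra_simps)
      also have "\<dots> \<le> \<bar>a\<bar> powr p + p * \<bar>e\<bar> * (\<bar>a\<bar> powr (p - 1) * \<bar>b\<bar>) + p * \<bar>e\<bar> powr p * \<bar>b\<bar>"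
        unfolding ee using p bp by (intro add_left_mono mult_left_mono) auto
      finally have "\<bar>a + e * b\<bar> powr p / D \<le> (\<bar>a\<bar> powr p + p * \<bar>e\<bar> * (\<bar>a\<bar> powr (p - 1) * \<bar>b\<bar>) + p * \<bar>e\<bar> powr p * \<bar>b\<bar>) / D"
        by (rule divide_right_mono) (simp add: D_def)
      also have "\<dots> = \<bar>a\<bar> powr p / D + (p * \<bar>e\<bar> * (\<bar>a\<bar> powr (p - 1) * (\<bar>b\<bar> / D)) + p * \<bar>e\<bar> powr p * (\<bar>b\<bar> / D))"
        by (simp add: add_divide_distrib)
      finally have "\<bar>a + e * b\<bar> powr p / D \<le> \<bar>a\<bar> powr p / D + (p * \<bar>e\<bar> * (\<bar>a\<bar> powr (p - 1) * (\<bar>b\<bar> / D)) + p * \<bar>e\<bar> powr p * (\<bar>b\<bar> / D))" .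
      then have "ennreal (\<bar>a + e * b\<bar> powr p / D)
          \<le> ennreal (\<bar>a\<bar> powr p / D + (p * \<bar>e\<bar> * (\<bar>a\<bar> powr (p - 1) * (\<bar>b\<bar> / D)) + p * \<bar>e\<bar> powr p * (\<bar>b\<bar> / D)))"
        by (rule ennreal_leI)
      also have "\<dots> = ennreal (\<bar>a\<bar> powr p / D)
          + (ennreal (p * \<bar>e\<bar>) * ennreal (\<bar>a\<bar> powr (p - 1) * (\<bar>b\<bar> / D)) + ennreal (p * \<bar>e\<bar> powr p) * ennreal (\<bar>b\<bar> / D))"
        using p by (intro ennreal_lin) (auto simp: D_def)
      finally have "ennreal (\<bar>a + e * b\<bar> powr p / D) \<le> ennreal (\<bar>a\<bar> powr p / D)
          + (ennreal (p * \<bar>e\<bar>) * ennreal (\<bar>a\<bar> powr (p - 1) * (\<bar>b\<bar> / D)) + ennreal (p * \<bar>e\<bar> powr p) * ennreal (\<bar>b\<bar> / D))" .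
      then show "ennreal (\<bar>f (fst z) + e * cutoff R (fst z) - (f (snd z) + e * cutoff R (snd z))\<bar> powr p / norm (fst z - snd z) powr \<alpha>)
        \<le> ennreal (\<bar>f (fst z) - f (snd z)\<bar> powr p / norm (fst z - snd z) powr \<alpha>)
        + (ennreal (p * \<bar>e\<bar>) * ennreal (\<bar>f (fst z) - f (snd z)\<bar> powr (p - 1) * (\<bar>cutoff R (fst z) - cutoff R (snd z)\<bar> / norm (fst z - snd z) powr \<alpha>))
        + ennreal (p * \<bar>e\<bar> powr p) * ennreal (\<bar>cutoff R (fst z) - cutoff R (snd z)\<bar> / norm (fst z - snd z) powr \<alpha>))"
        unfolding eq a_def b_def D_def .
    qed
    also have "\<dots> = I f + (ennreal (p * \<bar>e\<bar>) * B + ennreal (p * \<bar>e\<bar> powr p) * C)"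
      unfolding I_def B_def C_def by (simp add: nn_integral_add nn_integral_cmult)
    finally show ?thesis .
  qed
  show ?thesis
  proof (cases "B = \<infinity>")
    case True
    then show ?thesis using B by (simp add: top_unique)
  next
    case False
    then obtain b where b: "B = ennreal b" "b \<ge> 0" by (cases B) auto
    obtain c where c: "C = ennreal c" "c \<ge> 0" using C by (cases C) auto
    have "I f \<noteq> \<infinity>"
    proof
      assume "I f = \<infinity>"
      then show False using Ff p unfolding F by (simp add: ennreal_mult_top)
    qed
    then obtain i where i: "I f = ennreal i" "i \<ge> 0" by (cases "I f") auto
    define J where "J = (\<integral>x. \<xi> x * cutoff R x \<partial>lborel)"
    have step: "e * J \<le> \<bar>e\<bar> * b + \<bar>e\<bar> powr p * c" for e
    proof -
      have g: "(\<lambda>x. f x + e * cutoff R x) \<in> Lq_space 2"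
        using L2_lincomb[OF f2 cutoff_L2[OF R], of 1 e] by simp
      have "(\<lambda>x. \<xi> x * (f x + e * cutoff R x - f x)) = (\<lambda>x. e * (\<xi> x * cutoff R x))"
        by (simp add: fun_eq_iff)
      then have int: "(\<integral>x. \<xi> x * (f x + e * cutoff R x - f x) \<partial>lborel) = e * J"
        unfolding J_def by simp
      have "I (\<lambda>x. f x + e * cutoff R x) \<le> ennreal (i + (p * \<bar>e\<bar> * b + p * \<bar>e\<bar> powr p * c))"
        using growth[of e] p b(2) c(2) i(2) unfolding b(1) c(1) i(1) by (subst ennreal_lin) auto
      then have "ennreal (1 / p) * I (\<lambda>x. f x + e * cutoff R x) \<le> ennreal (1 / p) * ennreal (i + (p * \<bar>e\<bar> * b + p * \<bar>e\<bar> powr p * c))"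
        by (rule mult_left_mono) simp
      also have "\<dots> = ennreal (i / p + \<bar>e\<bar> * b + \<bar>e\<bar> powr p * c)"
        using p by (subst ennreal_mult'[symmetric]) (auto simp: field_simps)
      finally have "frac_p_energy s p (\<lambda>x. f x + e * cutoff R x) \<le> enn2ereal (ennreal (i / p + \<bar>e\<bar> * b + \<bar>e\<bar> powr p * c))"
        unfolding F by (simp add: less_eq_ennreal.rep_eq)
      then have "frac_p_energy s p (\<lambda>x. f x + e * cutoff R x) \<le> ereal (i / p + \<bar>e\<bar> * b + \<bar>e\<bar> powr p * c)"
        using p b c i by (subst (asm) enn2ereal_ennreal) auto
      then have "frac_p_energy s p f + ereal (e * J) \<le> ereal (i / p + \<bar>e\<bar> * b + \<bar>e\<bar> powr p * c)"
        by (rule order_trans[OF subg[OF g, unfolded int]])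
      moreover have "frac_p_energy s p f = ereal (i / p)"
        unfolding F i(1) using p i(2) by (subst ennreal_mult'[symmetric]) (auto simp: enn2ereal_ennreal)
      ultimately show ?thesis by simp
    qed
    have Jb: "\<bar>J\<bar> \<le> b + e powr (p - 1) * c" if e: "e > 0" for e
    proof -
      have ep: "e powr p = e * e powr (p - 1)" using powr_mult_base[of e "p - 1"] e by simp
      have "e * J \<le> e * (b + e powr (p - 1) * c)" "e * (- J) \<le> e * (b + e powr (p - 1) * c)"
        using step[of e] step[of "- e"] e by (simp_all add: ep distrib_left mult.assoc)
      then have "J \<le> b + e powr (p - 1) * c" "- J \<le> b + e powr (p - 1) * c"
        using e by (simp_all only: mult_le_cancel_left_pos)
      then show ?thesis by simp
    qed
    have "((\<lambda>e. e powr (p - 1)) \<longlongrightarrow> 0 powr (p - 1)) (at_right (0::real))"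
      using p by (intro tendsto_powr') (auto intro!: tendsto_intros simp: eventually_at_filter)
    then have "((\<lambda>e. b + e powr (p - 1) * c) \<longlongrightarrow> b + 0 powr (p - 1) * c) (at_right 0)"
      by (intro tendsto_add tendsto_mult tendsto_const)
    moreover have "\<forall>\<^sub>F e in at_right 0. \<bar>J\<bar> \<le> b + e powr (p - 1) * c"
      using eventually_at_right_less[of "0::real"] by eventually_elim (rule Jb)
    ultimately have "\<bar>J\<bar> \<le> b + 0 powr (p - 1) * c"
      by (rule tendsto_lowerbound) simp
    then have "ennreal \<bar>J\<bar> \<le> B" unfolding b(1) by (simp add: ennreal_leI)
    then show ?thesis using B unfolding J_def by (rule order_trans)
  qed
qed


section \<open>Subgradients of the energy tested with functions of the solution\<close>

text \<open>A function \<open>g\<close> whose differences are dominated by those of \<open>f\<close> has at most the energy of \<open>f\<close>, so the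
subgradient inequality leaves no room for a positive pairing with \<open>g - f\<close>.\<close>

lemma subgradient_contraction:
  fixes f g \<xi> :: "'a::euclidean_space \<Rightarrow> real"
  assumes p: "0 < p" and sub: "\<xi> \<in> L2_subdifferential (frac_p_energy s p) f"
    and g: "g \<in> Lq_space 2" and contr: "\<And>x y. \<bar>g x - g y\<bar> \<le> \<bar>f x - f y\<bar>"
  shows "(\<integral>x. \<xi> x * (g x - f x) \<partial>lborel) \<le> 0"
proof -
  have Ff: "frac_p_energy s p f < \<infinity>" and
    le: "frac_p_energy s p f + ereal (\<integral>x. \<xi> x * (g x - f x) \<partial>lborel) \<le> frac_p_energy s p g"
    using sub g by (auto simp: L2_subdifferential_def)
  have "frac_p_energy s p g \<le> frac_p_energy s p f"
    unfolding frac_p_energy_def less_eq_ennreal.rep_eq[symmetric]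
  proof (rule mult_left_mono[OF nn_integral_mono])
    fix z :: "'a \<times> 'a"
    obtain x y where z: "z = (x, y)" by (cases z)
    have "\<bar>g x - g y\<bar> powr p \<le> \<bar>f x - f y\<bar> powr p"
      using contr p by (intro powr_mono2) auto
    then show "(case z of (x, y) \<Rightarrow> ennreal (\<bar>g x - g y\<bar> powr p / norm (x - y) powr (real DIM('a) + s * p)))
       \<le> (case z of (x, y) \<Rightarrow> ennreal (\<bar>f x - f y\<bar> powr p / norm (x - y) powr (real DIM('a) + s * p)))"
      unfolding z prod.case by (intro ennreal_leI divide_right_mono) auto
  qed simp
  with le have "frac_p_energy s p f + ereal (\<integral>x. \<xi> x * (g x - f x) \<partial>lborel) \<le> frac_p_energy s p f"
    by (rule order_trans)
  moreover have "0 \<le> frac_p_energy s p f" by (simp add: frac_p_energy_def)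
  ultimately show ?thesis using Ff by (cases "frac_p_energy s p f") auto
qed

text \<open>A smooth convex approximation from below of the absolute value, which is quadratic near \<open>0\<close> and whose
derivative \<open>smooth_sgn k\<close> has Lipschitz constant \<open>1 / k\<close>. Thus its derivative maps \<open>L\<^sup>2\<close> to \<open>L\<^sup>2\<close>, which the
sign function does not.\<close>

definition smooth_abs :: "real \<Rightarrow> real \<Rightarrow> real" where
  "smooth_abs k v = sqrt (v\<^sup>2 + k\<^sup>2) - k"

definition smooth_sgn :: "real \<Rightarrow> real \<Rightarrow> real" where
  "smooth_sgn k v = v / sqrt (v\<^sup>2 + k\<^sup>2)"

lemma measurable_smooth_abs [measurable]: "smooth_abs k \<in> borel_measurable borel"
  and measurable_smooth_sgn [measurable]: "smooth_sgn k \<in> borel_measurable borel"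
  unfolding smooth_abs_def smooth_sgn_def by measurable

text \<open>Convexity and the quadratic upper bound in one identity: with \<open>A = sqrt (a\<^sup>2 + k\<^sup>2)\<close> and
\<open>B = sqrt (b\<^sup>2 + k\<^sup>2)\<close> the remainder of the first order expansion is \<open>(A B - a b - k\<^sup>2) / A\<close>. Its numerator is
nonnegative by the Cauchy-Schwarz inequality for \<open>(a, k)\<close> and \<open>(b, k)\<close>, and at most \<open>(b - a)\<^sup>2 / 2\<close> since
\<open>2 A B \<le> A\<^sup>2 + B\<^sup>2\<close>.\<close>

lemma smooth_abs_bregman:
  assumes k: "k > 0"
  shows "0 \<le> smooth_abs k b - smooth_abs k a - smooth_sgn k a * (b - a)"
    and "smooth_abs k b - smooth_abs k a - smooth_sgn k a * (b - a) \<le> (b - a)\<^sup>2 / (2 * k)"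
proof -
  define A where "A = sqrt (a\<^sup>2 + k\<^sup>2)"
  define B where "B = sqrt (b\<^sup>2 + k\<^sup>2)"
  have kA: "k \<le> A" unfolding A_def by (rule real_le_rsqrt) simp
  have kB: "k \<le> B" unfolding B_def by (rule real_le_rsqrt) simp
  have A2: "A\<^sup>2 = a\<^sup>2 + k\<^sup>2" and B2: "B\<^sup>2 = b\<^sup>2 + k\<^sup>2" by (simp_all add: A_def B_def)
  have id: "smooth_abs k b - smooth_abs k a - smooth_sgn k a * (b - a) = (A * B - a * b - k\<^sup>2) / A"
  proof -
    have "A * (smooth_abs k b - smooth_abs k a - smooth_sgn k a * (b - a)) = A * B - A\<^sup>2 - a * (b - a)"
    proof -
      have "smooth_abs k b = B - k" "smooth_abs k a = A - k" "smooth_sgn k a = a / A"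
        by (simp_all add: smooth_abs_def smooth_sgn_def A_def B_def)
      then show ?thesis using kA k by (simp add: right_diff_distrib power2_eq_square)
    qed
    also have "\<dots> = A * B - a * b - k\<^sup>2" unfolding A2 by (simp add: algebra_simps power2_eq_square)
    finally show ?thesis using kA k by (simp add: field_simps)
  qed
  have "a * b + k\<^sup>2 \<le> A * B"
  proof (rule power2_le_imp_le)
    have "(A * B)\<^sup>2 - (a * b + k\<^sup>2)\<^sup>2 = (k * (a - b))\<^sup>2"
      unfolding power_mult_distrib A2 B2 by (simp add: power2_eq_square algebra_simps)
    moreover have "0 \<le> (k * (a - b))\<^sup>2" by simp
    ultimately show "(a * b + k\<^sup>2)\<^sup>2 \<le> (A * B)\<^sup>2" by linarith
    show "0 \<le> A * B" using kA kB k by simp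
  qed
  then show "0 \<le> smooth_abs k b - smooth_abs k a - smooth_sgn k a * (b - a)"
    unfolding id using kA k by simp
  have "2 * (A * B) \<le> A\<^sup>2 + B\<^sup>2" using sum_squares_bound[of A B] by simp
  then have "A * B - a * b - k\<^sup>2 \<le> (b - a)\<^sup>2 / 2"
    unfolding A2 B2 by (simp add: power2_eq_square algebra_simps)
  then have "(A * B - a * b - k\<^sup>2) / A \<le> (b - a)\<^sup>2 / 2 / A"
    using kA k by (intro divide_right_mono) auto
  also have "\<dots> \<le> (b - a)\<^sup>2 / 2 / k" using kA k by (intro divide_left_mono) auto
  finally show "smooth_abs k b - smooth_abs k a - smooth_sgn k a * (b - a) \<le> (b - a)\<^sup>2 / (2 * k)"
    unfolding id by simp
qed

text \<open>Add the expansions at \<open>a\<close> and at \<open>b\<close>.\<close>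

lemma smooth_sgn_mono_Lipschitz:
  assumes k: "k > 0"
  shows "0 \<le> (smooth_sgn k b - smooth_sgn k a) * (b - a)"
    and "(smooth_sgn k b - smooth_sgn k a) * (b - a) \<le> (b - a)\<^sup>2 / k"
proof -
  have "(smooth_sgn k b - smooth_sgn k a) * (b - a)
     = (smooth_abs k b - smooth_abs k a - smooth_sgn k a * (b - a)) + (smooth_abs k a - smooth_abs k b - smooth_sgn k b * (a - b))"
    by (simp add: algebra_simps)
  then show "0 \<le> (smooth_sgn k b - smooth_sgn k a) * (b - a)"
    and "(smooth_sgn k b - smooth_sgn k a) * (b - a) \<le> (b - a)\<^sup>2 / k"
    using smooth_abs_bregman[OF k, of a b] smooth_abs_bregman[OF k, of b a]
    by (simp_all add: power2_commute[of a b])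
qed

lemma abs_smooth_sgn_le: "k > 0 \<Longrightarrow> \<bar>smooth_sgn k v\<bar> \<le> 1 / k * \<bar>v\<bar>"
proof -
  assume k: "k > 0"
  have "k \<le> sqrt (v\<^sup>2 + k\<^sup>2)" by (rule real_le_rsqrt) simp
  then have "\<bar>v\<bar> / sqrt (v\<^sup>2 + k\<^sup>2) \<le> \<bar>v\<bar> / k"
    using k by (intro divide_left_mono mult_pos_pos) linarith+
  then show ?thesis using k by (simp add: smooth_sgn_def abs_divide)
qed

lemma smooth_abs_bounds:
  assumes k: "k > 0" shows "0 \<le> smooth_abs k v" "smooth_abs k v \<le> \<bar>v\<bar>" "\<bar>v\<bar> - k \<le> smooth_abs k v"
proof -
  have "k \<le> sqrt (v\<^sup>2 + k\<^sup>2)" by (rule real_le_rsqrt) simp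
  then show "0 \<le> smooth_abs k v" by (simp add: smooth_abs_def)
  have "sqrt (v\<^sup>2 + k\<^sup>2) \<le> sqrt (v\<^sup>2) + sqrt (k\<^sup>2)" by (rule sqrt_add_le_add_sqrt) auto
  then show "smooth_abs k v \<le> \<bar>v\<bar>" using k by (simp add: smooth_abs_def)
  have "\<bar>v\<bar> \<le> sqrt (v\<^sup>2 + k\<^sup>2)" by (rule real_le_rsqrt) simp
  then show "\<bar>v\<bar> - k \<le> smooth_abs k v" by (simp add: smooth_abs_def)
qed

lemma abs_smooth_abs_diff_le:
  assumes k: "k > 0"
  shows "\<bar>smooth_abs k b - smooth_abs k a\<bar> \<le> 1 / k * (\<bar>b - a\<bar> * (\<bar>a\<bar> + \<bar>b\<bar>))"
proof -
  have "smooth_sgn k a * (b - a) \<le> smooth_abs k b - smooth_abs k a"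
    "smooth_abs k b - smooth_abs k a \<le> smooth_sgn k b * (b - a)"
    using smooth_abs_bregman(1)[OF k, of b a] smooth_abs_bregman(1)[OF k, of a b] by (simp_all add: algebra_simps)
  then have "\<bar>smooth_abs k b - smooth_abs k a\<bar> \<le> \<bar>smooth_sgn k a * (b - a)\<bar> + \<bar>smooth_sgn k b * (b - a)\<bar>"
    by linarith
  also have "\<dots> = \<bar>smooth_sgn k a\<bar> * \<bar>b - a\<bar> + \<bar>smooth_sgn k b\<bar> * \<bar>b - a\<bar>" by (simp add: abs_mult)
  also have "\<dots> \<le> (1 / k * \<bar>a\<bar>) * \<bar>b - a\<bar> + (1 / k * \<bar>b\<bar>) * \<bar>b - a\<bar>"
    using abs_smooth_sgn_le[OF k] by (intro add_mono mult_right_mono) auto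
  also have "\<dots> = 1 / k * (\<bar>b - a\<bar> * (\<bar>a\<bar> + \<bar>b\<bar>))" by (simp add: algebra_simps)
  finally show ?thesis .
qed

lemma smooth_abs_integrable:
  assumes "k > 0" "integrable lborel f"
  shows "integrable lborel (\<lambda>x. smooth_abs k (f x))"
proof (rule Bochner_Integration.integrable_bound[OF assms(2)])
  have [measurable]: "f \<in> borel_measurable lborel" using assms(2) by (rule borel_measurable_integrable)
  show "(\<lambda>x. smooth_abs k (f x)) \<in> borel_measurable lborel" by measurable
  show "AE x in lborel. norm (smooth_abs k (f x)) \<le> norm (f x)"
    using smooth_abs_bounds[OF assms(1)] by simp
qed

lemma smooth_abs_integral_tendsto:
  assumes f: "integrable lborel f"
  shows "(\<lambda>n. \<integral>x. smooth_abs (1 / real (Suc n)) (f x) \<partial>lborel) \<longlonglongrightarrow> (\<integral>x. \<bar>f x\<bar> \<partial>lborel)"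
proof (rule integral_dominated_convergence)
  have [measurable]: "f \<in> borel_measurable lborel" using f by (rule borel_measurable_integrable)
  show "(\<lambda>x. \<bar>f x\<bar>) \<in> borel_measurable lborel" by measurable
  show "(\<lambda>x. smooth_abs (1 / real (Suc n)) (f x)) \<in> borel_measurable lborel" for n by measurable
  show "integrable lborel (\<lambda>x. \<bar>f x\<bar>)" using f by simp
  show "AE x in lborel. norm (smooth_abs (1 / real (Suc n)) (f x)) \<le> \<bar>f x\<bar>" for n
    using smooth_abs_bounds[of "1 / real (Suc n)"] by simp
  show "AE x in lborel. (\<lambda>n. smooth_abs (1 / real (Suc n)) (f x)) \<longlonglongrightarrow> \<bar>f x\<bar>"
  proof (rule AE_I2, rule tendsto_sandwich)
    fix x
    have "(\<lambda>n. \<bar>f x\<bar> - 1 / real (Suc n)) \<longlonglongrightarrow> \<bar>f x\<bar> - 0"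
      by (intro tendsto_diff tendsto_const LIMSEQ_Suc lim_1_over_n)
    then show "(\<lambda>n. \<bar>f x\<bar> - 1 / real (Suc n)) \<longlonglongrightarrow> \<bar>f x\<bar>" by simp
    show "(\<lambda>n. \<bar>f x\<bar>) \<longlonglongrightarrow> \<bar>f x\<bar>" by simp
  qed (use smooth_abs_bounds[of "1 / real (Suc _)"] in \<open>auto intro!: always_eventually\<close>)
qed

text \<open>As \<open>smooth_sgn k\<close> is nondecreasing with Lipschitz constant \<open>1 / k\<close>, the map
\<open>v \<mapsto> v - k smooth_sgn k v\<close> is a contraction of the line, and \<open>subgradient_contraction\<close> applies.\<close>

lemma subgradient_smooth_sgn_nonneg:
  fixes f \<xi> :: "'a::euclidean_space \<Rightarrow> real"
  assumes p: "0 < p" and k: "k > 0" and sub: "\<xi> \<in> L2_subdifferential (frac_p_energy s p) f"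
  shows "0 \<le> (\<integral>x. \<xi> x * smooth_sgn k (f x) \<partial>lborel)"
proof -
  have f: "f \<in> Lq_space 2" using sub by (simp add: L2_subdifferential_def)
  then have [measurable]: "f \<in> borel_measurable borel" by (rule measurable_Lq_space)
  have \<beta>: "(\<lambda>x. smooth_sgn k (f x)) \<in> Lq_space 2"
    by (rule L2_mono[OF f _ abs_smooth_sgn_le[OF k]]) measurable
  define g where "g x = f x - k * smooth_sgn k (f x)" for x
  have "g \<in> Lq_space 2" using L2_lincomb[OF f \<beta>, of 1 "- k"] by (simp add: g_def[abs_def])
  moreover have "\<bar>g x - g y\<bar> \<le> \<bar>f x - f y\<bar>" for x y
  proof -
    define d where "d = smooth_sgn k (f x) - smooth_sgn k (f y)"
    define e where "e = f x - f y"
    have 1: "0 \<le> d * e" "d * e \<le> e\<^sup>2 / k"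
      using smooth_sgn_mono_Lipschitz[OF k, of "f x" "f y"] by (simp_all add: d_def e_def)
    have "\<bar>e - k * d\<bar> \<le> \<bar>e\<bar>"
    proof (cases "e = 0")
      case True
      then have "f x = f y" by (simp add: e_def)
      then show ?thesis by (simp add: e_def d_def)
    next
      case False
      have "k * (d * e) \<le> k * (e\<^sup>2 / k)" using 1(2) k by (intro mult_left_mono) auto
      then have 2: "(k * d) * e \<le> e * e" using k by (simp add: power2_eq_square mult.assoc)
      have 3: "0 \<le> (k * d) * e" using 1(1) k by (simp add: mult.assoc)
      show ?thesis
      proof (cases "e > 0")
        case True
        then have "k * d \<le> e" "0 \<le> k * d" using 2 3 by (auto simp: zero_le_mult_iff)
        then show ?thesis by simp
      next
        case neg: False
        then have "e < 0" using False by simp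
        then have "e \<le> k * d" "k * d \<le> 0" using 2 3 by (auto simp: zero_le_mult_iff)
        then show ?thesis by simp
      qed
    qed
    moreover have "g x - g y = e - k * d" by (simp add: g_def d_def e_def algebra_simps)
    ultimately show ?thesis by (simp add: e_def)
  qed
  ultimately have "(\<integral>x. \<xi> x * (g x - f x) \<partial>lborel) \<le> 0"
    by (rule subgradient_contraction[OF p sub])
  moreover have "(\<lambda>x. \<xi> x * (g x - f x)) = (\<lambda>x. - k * (\<xi> x * smooth_sgn k (f x)))"
    by (simp add: g_def fun_eq_iff)
  ultimately show ?thesis using k by (simp add: mult_le_0_iff zero_le_mult_iff)
qed


section \<open>Time derivatives along gradient flows\<close>

text \<open>A velocity chosen at all good times, together with the null set of bad ones. The velocity is minus the
operator, which is half of the subdifferential; hence the factor \<open>- 2\<close>.\<close>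

lemma gradient_flow_velocity:
  assumes "L2_gradient_flow s p v"
  obtains N w where "N \<in> null_sets lborel"
    "\<And>t. 0 < t \<Longrightarrow> t \<notin> N \<Longrightarrow> w t \<in> Lq_space 2"
    "\<And>t. 0 < t \<Longrightarrow> t \<notin> N \<Longrightarrow> has_Lq_derivative 2 v (w t) t"
    "\<And>t. 0 < t \<Longrightarrow> t \<notin> N \<Longrightarrow> (\<lambda>x. - 2 * w t x) \<in> L2_subdifferential (frac_p_energy s p) (v t)"
proof -
  have "AE t in lborel. 0 < t \<longrightarrow>
        (\<exists>w\<in>Lq_space 2. has_Lq_derivative 2 v w t \<and> (\<lambda>x. - w x) \<in> frac_p_Laplacian s p (v t))"
    using assms by (simp add: L2_gradient_flow_def)
  then obtain N where N: "N \<in> null_sets lborel" and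
    "{t \<in> space lborel. \<not> (0 < t \<longrightarrow>
        (\<exists>w\<in>Lq_space 2. has_Lq_derivative 2 v w t \<and> (\<lambda>x. - w x) \<in> frac_p_Laplacian s p (v t)))} \<subseteq> N"
    by (elim AE_E) (auto simp: null_sets_def)
  then have "\<forall>t\<in>{0<..} - N. \<exists>w. w \<in> Lq_space 2 \<and> has_Lq_derivative 2 v w t \<and> (\<lambda>x. - w x) \<in> frac_p_Laplacian s p (v t)"
    by auto
  from bchoice[OF this] obtain w where
    w: "\<forall>t\<in>{0<..} - N. w t \<in> Lq_space 2 \<and> has_Lq_derivative 2 v (w t) t \<and> (\<lambda>x. - w t x) \<in> frac_p_Laplacian s p (v t)"
    by blast
  show thesis
  proof (rule that[OF N, of w])
    fix t :: real assume "0 < t" "t \<notin> N"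
    then have t: "t \<in> {0<..} - N" by simp
    show "w t \<in> Lq_space 2" "has_Lq_derivative 2 v (w t) t" using w t by blast+
    have "(\<lambda>x. - w t x) \<in> frac_p_Laplacian s p (v t)" using w t by blast
    then show "(\<lambda>x. - 2 * w t x) \<in> L2_subdifferential (frac_p_energy s p) (v t)"
      by (simp add: frac_p_Laplacian_def)
  qed
qed

lemma tendsto_inner_difference_quotient:
  assumes t: "0 < t" and v: "\<And>r. 0 \<le> r \<Longrightarrow> v r \<in> Lq_space 2" and w: "w \<in> Lq_space 2"
    and \<phi>: "\<phi> \<in> Lq_space 2" and deriv: "has_Lq_derivative 2 v w t"
  shows "((\<lambda>r. \<integral>x. \<phi> x * ((v r x - v t x) / (r - t)) \<partial>lborel) \<longlongrightarrow> (\<integral>x. \<phi> x * w x \<partial>lborel)) (at t)"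
proof (rule LIM_zero_cancel, rule Lim_null_comparison)
  let ?q = "\<lambda>r x. (v r x - v t x) / (r - t)"
  show "((\<lambda>r. Lq_norm 2 \<phi> * Lq_dist 2 (?q r) w) \<longlongrightarrow> 0) (at t)"
    using deriv unfolding has_Lq_derivative_def by (rule tendsto_mult_right_zero)
  have "\<forall>\<^sub>F r in at t. 0 < r"
    using t by (intro order_tendstoD(1)[OF tendsto_ident_at])
  then show "\<forall>\<^sub>F r in at t. norm ((\<integral>x. \<phi> x * ?q r x \<partial>lborel) - (\<integral>x. \<phi> x * w x \<partial>lborel))
      \<le> Lq_norm 2 \<phi> * Lq_dist 2 (?q r) w"
  proof eventually_elim
    case (elim r)
    have q: "?q r \<in> Lq_space 2" using elim t by (intro L2_quotient v) auto
    have "(\<integral>x. \<phi> x * ?q r x \<partial>lborel) - (\<integral>x. \<phi> x * w x \<partial>lborel) = (\<integral>x. \<phi> x * (?q r x - w x) \<partial>lborel)"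
      unfolding right_diff_distrib
      by (rule Bochner_Integration.integral_diff[symmetric]) (intro L2_mult_integrable \<phi> q w)+
    then show ?case
      using L2_Cauchy_Schwarz[OF \<phi> L2_diff[OF q w]] by (simp add: Lq_dist_def)
  qed
qed

lemma has_real_derivative_inner:
  assumes t: "0 < t" and v: "\<And>r. 0 \<le> r \<Longrightarrow> v r \<in> Lq_space 2" and w: "w \<in> Lq_space 2"
    and \<phi>: "\<phi> \<in> Lq_space 2" and deriv: "has_Lq_derivative 2 v w t"
  shows "((\<lambda>r. \<integral>x. \<phi> x * v r x \<partial>lborel) has_real_derivative (\<integral>x. \<phi> x * w x \<partial>lborel)) (at t)"
  unfolding has_field_derivative_iff
proof (rule Lim_transform_eventually[OF tendsto_inner_difference_quotient[OF assms]])
  have "\<forall>\<^sub>F r in at t. 0 < r"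
    using t by (intro order_tendstoD(1)[OF tendsto_ident_at])
  then show "\<forall>\<^sub>F r in at t. (\<integral>x. \<phi> x * ((v r x - v t x) / (r - t)) \<partial>lborel)
      = ((\<integral>x. \<phi> x * v r x \<partial>lborel) - (\<integral>x. \<phi> x * v t x \<partial>lborel)) / (r - t)"
  proof eventually_elim
    case (elim r)
    have "integrable lborel (\<lambda>x. \<phi> x * v r x)" "integrable lborel (\<lambda>x. \<phi> x * v t x)"
      using elim t by (auto intro!: L2_mult_integrable \<phi> v)
    then have "(\<integral>x. \<phi> x * v r x \<partial>lborel) - (\<integral>x. \<phi> x * v t x \<partial>lborel) = (\<integral>x. \<phi> x * (v r x - v t x) \<partial>lborel)"
      unfolding right_diff_distrib by (rule Bochner_Integration.integral_diff[symmetric])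
    then show ?case by simp
  qed
qed

text \<open>The remainder of the first order expansion of \<open>\<integral> j(v(r))\<close> at \<open>t\<close> is at most
\<open>\<parallel>v(r) - v(t)\<parallel>\<^sup>2 / (2 k)\<close>. After division by \<open>r - t\<close> this is \<open>|r - t| / (2 k)\<close> times the square of the norm of a
difference quotient, which is bounded near \<open>t\<close>.\<close>

lemma has_real_derivative_smooth_abs:
  assumes t: "0 < t" and v: "\<And>r. 0 \<le> r \<Longrightarrow> v r \<in> Lq_space 2"
    and v1: "\<And>r. 0 \<le> r \<Longrightarrow> v r \<in> Lq_space 1" and w: "w \<in> Lq_space 2"
    and k: "k > 0" and deriv: "has_Lq_derivative 2 v w t"
  shows "((\<lambda>r. \<integral>x. smooth_abs k (v r x) \<partial>lborel) has_real_derivative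
           (\<integral>x. smooth_sgn k (v t x) * w x \<partial>lborel)) (at t)"
  unfolding has_field_derivative_iff
proof -
  let ?q = "\<lambda>r x. (v r x - v t x) / (r - t)"
  let ?J = "\<lambda>r. \<integral>x. smooth_abs k (v r x) \<partial>lborel"
  have vt: "v t \<in> Lq_space 2" using t v by simp
  have [measurable]: "v t \<in> borel_measurable borel" using vt by (rule measurable_Lq_space)
  have \<beta>: "(\<lambda>x. smooth_sgn k (v t x)) \<in> Lq_space 2"
    by (rule L2_mono[OF vt _ abs_smooth_sgn_le[OF k]]) measurable
  let ?L = "\<lambda>r. \<integral>x. smooth_sgn k (v t x) * ?q r x \<partial>lborel"
  have L: "(?L \<longlongrightarrow> (\<integral>x. smooth_sgn k (v t x) * w x \<partial>lborel)) (at t)"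
    by (rule tendsto_inner_difference_quotient[OF t v w \<beta> deriv])
  have "((\<lambda>r. \<bar>r - t\<bar> / (2 * k) * (Lq_dist 2 (?q r) w + Lq_norm 2 w)\<^sup>2) \<longlongrightarrow> \<bar>t - t\<bar> / (2 * k) * (0 + Lq_norm 2 w)\<^sup>2) (at t)"
    using deriv k unfolding has_Lq_derivative_def by (intro tendsto_intros) auto
  then have bnd: "((\<lambda>r. \<bar>r - t\<bar> / (2 * k) * (Lq_dist 2 (?q r) w + Lq_norm 2 w)\<^sup>2) \<longlongrightarrow> 0) (at t)" by simp
  have "((\<lambda>r. (?J r - ?J t) / (r - t) - ?L r) \<longlongrightarrow> 0) (at t)"
  proof (rule Lim_null_comparison[OF _ bnd])
    have "\<forall>\<^sub>F r in at t. 0 < r"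
      using t by (intro order_tendstoD(1)[OF tendsto_ident_at])
    moreover have "\<forall>\<^sub>F r in at t. r \<noteq> t" by (simp add: eventually_at_filter)
    ultimately show "\<forall>\<^sub>F r in at t. norm ((?J r - ?J t) / (r - t) - ?L r)
        \<le> \<bar>r - t\<bar> / (2 * k) * (Lq_dist 2 (?q r) w + Lq_norm 2 w)\<^sup>2"
    proof eventually_elim
      case (elim r)
      have vr: "v r \<in> Lq_space 2" using elim v by simp
      have q: "?q r \<in> Lq_space 2" by (rule L2_quotient[OF vr vt])
      have d: "(\<lambda>x. v r x - v t x) \<in> Lq_space 2" by (rule L2_diff[OF vr vt])
      have i1: "integrable lborel (\<lambda>x. smooth_abs k (v r x))" "integrable lborel (\<lambda>x. smooth_abs k (v t x))"
        using elim t v1 k by (auto intro!: smooth_abs_integrable simp: Lq_space_1_iff)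
      have i2: "integrable lborel (\<lambda>x. smooth_sgn k (v t x) * (v r x - v t x))"
        by (rule L2_mult_integrable[OF \<beta> d])
      have i3: "integrable lborel (\<lambda>x. (v r x - v t x)\<^sup>2 / (2 * k))" using d by (simp add: Lq_space_2_iff)
      define E where "E = (\<integral>x. smooth_abs k (v r x) - smooth_abs k (v t x) - smooth_sgn k (v t x) * (v r x - v t x) \<partial>lborel)"
      have E_eq: "E = ?J r - ?J t - (r - t) * ?L r"
        using i1 i2 elim by (simp add: E_def)
      have "0 \<le> E" unfolding E_def using smooth_abs_bregman(1)[OF k] by (intro integral_nonneg_AE) auto
      have "E \<le> (\<integral>x. (v r x - v t x)\<^sup>2 / (2 * k) \<partial>lborel)"
        unfolding E_def using smooth_abs_bregman(2)[OF k] i1 i2 i3 by (intro integral_mono) auto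
      also have "\<dots> = (\<integral>x. (r - t)\<^sup>2 / (2 * k) * (?q r x)\<^sup>2 \<partial>lborel)"
        using elim by (intro Bochner_Integration.integral_cong) (auto simp: power_divide)
      also have "\<dots> = (r - t)\<^sup>2 / (2 * k) * (Lq_norm 2 (?q r))\<^sup>2"
        by (simp add: Lq_norm_2)
      also have "\<dots> \<le> (r - t)\<^sup>2 / (2 * k) * (Lq_dist 2 (?q r) w + Lq_norm 2 w)\<^sup>2"
        using k L2_norm_le_dist[OF q w] by (intro mult_left_mono power_mono) (auto simp: Lq_norm_nonneg)
      finally have "\<bar>E\<bar> / \<bar>r - t\<bar> \<le> (r - t)\<^sup>2 / (2 * k) * (Lq_dist 2 (?q r) w + Lq_norm 2 w)\<^sup>2 / \<bar>r - t\<bar>"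
        using \<open>0 \<le> E\<close> by (intro divide_right_mono) auto
      also have "\<dots> = \<bar>r - t\<bar> / (2 * k) * (Lq_dist 2 (?q r) w + Lq_norm 2 w)\<^sup>2"
      proof -
        have "(r - t)\<^sup>2 = \<bar>r - t\<bar> * \<bar>r - t\<bar>" by (simp add: power2_eq_square)
        moreover have "d * d / (2 * k) * Y / d = d / (2 * k) * Y" if "d \<noteq> 0" for d Y :: real
          using that by simp
        ultimately show ?thesis using elim by (simp only: abs_eq_0 right_minus_eq not_False_eq_True)
      qed
      finally have "\<bar>E / (r - t)\<bar> \<le> \<bar>r - t\<bar> / (2 * k) * (Lq_dist 2 (?q r) w + Lq_norm 2 w)\<^sup>2"
        by (simp add: abs_divide)
      moreover have "(?J r - ?J t) / (r - t) - ?L r = E / (r - t)"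
        unfolding E_eq using elim by (simp add: diff_divide_distrib)
      ultimately show ?case by simp
    qed
  qed
  from tendsto_add[OF this L]
  show "((\<lambda>r. (?J r - ?J t) / (r - t)) \<longlongrightarrow> (\<integral>x. smooth_sgn k (v t x) * w x \<partial>lborel)) (at t)" by simp
qed


section \<open>Decrease of the norm and conservation of mass\<close>

text \<open>The derivative of \<open>\<integral> j(v(t))\<close> is \<open>\<integral> \<beta>(v(t)) w(t) \<le> 0\<close> almost everywhere. Absolute continuity is that
of \<open>v\<close> in \<open>L\<^sup>2\<close>, because \<open>|j b - j a| \<le> |b - a| (|a| + |b|) / k\<close> and \<open>v\<close> is bounded in \<open>L\<^sup>2\<close> on \<open>[a, b]\<close>.\<close>

lemma gradient_flow_smooth_abs_le:
  fixes v :: "real \<Rightarrow> 'a::euclidean_space \<Rightarrow> real"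
  assumes p: "0 < p" and flow: "L2_gradient_flow s p v"
    and v1: "\<And>t. 0 \<le> t \<Longrightarrow> v t \<in> Lq_space 1" and k: "k > 0" and ab: "0 < a" "a < b"
  shows "(\<integral>x. smooth_abs k (v b x) \<partial>lborel) \<le> (\<integral>x. smooth_abs k (v a x) \<partial>lborel)"
proof -
  have cont: "continuous_Lq_curve 2 v" and ac: "abs_continuous_Lq_on 2 {a..b} v"
    using flow ab by (auto simp: L2_gradient_flow_def)
  have v2: "v t \<in> Lq_space 2" if "0 \<le> t" for t using cont that by (simp add: continuous_Lq_curve_def)
  obtain N w where N: "N \<in> null_sets lborel"
    and w: "\<And>t. 0 < t \<Longrightarrow> t \<notin> N \<Longrightarrow> w t \<in> Lq_space 2"
      "\<And>t. 0 < t \<Longrightarrow> t \<notin> N \<Longrightarrow> has_Lq_derivative 2 v (w t) t"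
      "\<And>t. 0 < t \<Longrightarrow> t \<notin> N \<Longrightarrow> (\<lambda>x. - 2 * w t x) \<in> L2_subdifferential (frac_p_energy s p) (v t)"
    using gradient_flow_velocity[OF flow] by metis
  obtain M where M: "\<And>t. t \<in> {a..b} \<Longrightarrow> Lq_norm 2 (v t) \<le> M"
    using continuous_L2_curve_bounded[OF cont, of a b] ab by auto
  have M0: "0 \<le> M" using M[of a] ab Lq_norm_nonneg[of 2 "v a"] by simp
  define J where "J t = (\<integral>x. smooth_abs k (v t x) \<partial>lborel)" for t
  define D where "D t = (if t \<in> N then 0 else \<integral>x. smooth_sgn k (v t x) * w t x \<partial>lborel)" for t
  have lip: "\<bar>J t - J r\<bar> \<le> (2 * M / k) * Lq_dist 2 (v t) (v r)" if t: "t \<in> {a..b}" and r: "r \<in> {a..b}" for t r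
  proof -
    have 2: "v t \<in> Lq_space 2" "v r \<in> Lq_space 2" using t r ab v2 by auto
    have 1: "integrable lborel (v t)" "integrable lborel (v r)"
      using t r ab v1 by (auto simp flip: Lq_space_1_iff)
    have abs2: "(\<lambda>x. \<bar>f x\<bar>) \<in> Lq_space 2" if "f \<in> Lq_space 2" for f :: "'a \<Rightarrow> real"
      using that by (auto simp: Lq_space_2_iff)
    have absn: "Lq_norm 2 (\<lambda>x. \<bar>f x\<bar>) = Lq_norm 2 f" for f :: "'a \<Rightarrow> real" by (simp add: Lq_norm_2)
    have d: "(\<lambda>x. \<bar>v t x - v r x\<bar>) \<in> Lq_space 2" by (intro abs2 L2_diff 2)
    have e: "(\<lambda>x. \<bar>v r x\<bar> + \<bar>v t x\<bar>) \<in> Lq_space 2"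
      using L2_lincomb[OF abs2[OF 2(2)] abs2[OF 2(1)], of 1 1] by simp
    have "\<bar>J t - J r\<bar> = \<bar>\<integral>x. smooth_abs k (v t x) - smooth_abs k (v r x) \<partial>lborel\<bar>"
      unfolding J_def using 1 k by (simp add: smooth_abs_integrable)
    also have "\<dots> \<le> (\<integral>x. \<bar>smooth_abs k (v t x) - smooth_abs k (v r x)\<bar> \<partial>lborel)"
      by (rule integral_abs_bound)
    also have "\<dots> \<le> (\<integral>x. 1 / k * (\<bar>v t x - v r x\<bar> * (\<bar>v r x\<bar> + \<bar>v t x\<bar>)) \<partial>lborel)"
    proof (rule integral_mono)
      show "integrable lborel (\<lambda>x. \<bar>smooth_abs k (v t x) - smooth_abs k (v r x)\<bar>)"
        using 1 k by (intro integrable_abs Bochner_Integration.integrable_diff smooth_abs_integrable)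
      show "integrable lborel (\<lambda>x. 1 / k * (\<bar>v t x - v r x\<bar> * (\<bar>v r x\<bar> + \<bar>v t x\<bar>)))"
        using L2_mult_integrable[OF d e] by simp
    qed (rule abs_smooth_abs_diff_le[OF k])
    also have "\<dots> = 1 / k * (\<integral>x. \<bar>v t x - v r x\<bar> * (\<bar>v r x\<bar> + \<bar>v t x\<bar>) \<partial>lborel)" by simp
    also have "\<dots> \<le> 1 / k * (Lq_dist 2 (v t) (v r) * (2 * M))"
    proof (rule mult_left_mono)
      have "(\<integral>x. \<bar>v t x - v r x\<bar> * (\<bar>v r x\<bar> + \<bar>v t x\<bar>) \<partial>lborel)
          \<le> Lq_norm 2 (\<lambda>x. \<bar>v t x - v r x\<bar>) * Lq_norm 2 (\<lambda>x. \<bar>v r x\<bar> + \<bar>v t x\<bar>)"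
        using L2_Cauchy_Schwarz[OF d e] by simp
      also have "\<dots> \<le> Lq_dist 2 (v t) (v r) * (2 * M)"
        unfolding absn Lq_dist_def
        using L2_norm_triangle[OF abs2[OF 2(2)] abs2[OF 2(1)]] M[OF t] M[OF r] unfolding absn
        by (intro mult_left_mono) (auto simp: Lq_norm_nonneg)
      finally show "(\<integral>x. \<bar>v t x - v r x\<bar> * (\<bar>v r x\<bar> + \<bar>v t x\<bar>) \<partial>lborel) \<le> Lq_dist 2 (v t) (v r) * (2 * M)" .
    qed (use k in simp)
    also have "\<dots> = (2 * M / k) * Lq_dist 2 (v t) (v r)" by simp
    finally show ?thesis .
  qed
  have "(D has_integral (J b - J a)) {a..b}"
  proof (rule absolutely_continuous_has_integral_derivative[OF _ _ N])
    show "a \<le> b" using ab by simp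
    fix \<epsilon> :: real assume "\<epsilon> > 0"
    then show "\<exists>\<delta>>0. \<forall>\<D>. \<D> division_of (\<Union>\<D>) \<and> \<Union>\<D> \<subseteq> {a..b} \<and>
        (\<Sum>K\<in>\<D>. Sup K - Inf K) < \<delta> \<longrightarrow> (\<Sum>K\<in>\<D>. \<bar>J (Sup K) - J (Inf K)\<bar>) < \<epsilon>"
      using M0 k by (intro abs_continuous_Lq_on_functional[OF ac _ lip]) auto
  next
    fix t assume "t \<in> {a..b} - N"
    then have t: "0 < t" "t \<notin> N" using ab by auto
    then show "(J has_real_derivative D t) (at t)"
      unfolding J_def[abs_def] D_def
      using has_real_derivative_smooth_abs[OF t(1) v2 v1 w(1)[OF t] k w(2)[OF t]] by simp
  next
    fix t assume "t \<in> N" then show "D t = 0" by (simp add: D_def)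
  qed
  moreover have "D t \<le> 0" if "t \<in> {a..b}" for t
  proof (cases "t \<in> N")
    case False
    have t: "0 < t" using that ab by simp
    have "0 \<le> (\<integral>x. (- 2 * w t x) * smooth_sgn k (v t x) \<partial>lborel)"
      by (rule subgradient_smooth_sgn_nonneg[OF p k w(3)[OF t False]])
    also have "(\<lambda>x. (- 2 * w t x) * smooth_sgn k (v t x)) = (\<lambda>x. - 2 * (smooth_sgn k (v t x) * w t x))"
      by (simp add: fun_eq_iff)
    finally show ?thesis using False by (simp add: D_def)
  qed (simp add: D_def)
  ultimately have "J b - J a \<le> 0" by (rule has_integral_le[OF _ has_integral_0])
  then show ?thesis by (simp add: J_def)
qed

lemma gradient_flow_L1_norm_le:
  fixes v :: "real \<Rightarrow> 'a::euclidean_space \<Rightarrow> real"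
  assumes p: "0 < p" and flow: "L2_gradient_flow s p v"
    and v1: "\<And>t. 0 \<le> t \<Longrightarrow> v t \<in> Lq_space 1" and ab: "0 < a" "a \<le> b"
  shows "(\<integral>x. \<bar>v b x\<bar> \<partial>lborel) \<le> (\<integral>x. \<bar>v a x\<bar> \<partial>lborel)"
proof (cases "a = b")
  case False
  then have "a < b" using ab by simp
  have "integrable lborel (v a)" "integrable lborel (v b)"
    using v1[of a] v1[of b] ab by (auto simp: Lq_space_1_iff)
  then show ?thesis
    by (intro LIMSEQ_le[OF smooth_abs_integral_tendsto smooth_abs_integral_tendsto])
      (auto intro!: gradient_flow_smooth_abs_le[OF p flow v1 _ ab(1) \<open>a < b\<close>])
qed simp

text \<open>The mass inside the cutoff, \<open>g n t\<close>, is the integral of its derivative \<open>D n\<close>, and \<open>|D n t|\<close> is at most the boundary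
term \<open>T n t\<close>. For each time this tends to \<open>0\<close> as \<open>n \<rightarrow> \<infinity>\<close>, and it is bounded on \<open>[a, b]\<close> through the \<open>L\<^sup>1\<close> norm of
\<open>v(a)\<close>, which bounds that of \<open>v(t)\<close>. Dominated convergence concludes.\<close>

lemma gradient_flow_mass_eq:
  fixes v :: "real \<Rightarrow> 'a::euclidean_space \<Rightarrow> real"
  assumes s: "0 < s" "s < 1" and p: "p = 2 * real DIM('a) / (real DIM('a) + s)" and sp: "s * p < 1"
    and flow: "L2_gradient_flow s p v"
    and v1: "\<And>t. 0 \<le> t \<Longrightarrow> v t \<in> Lq_space 1" and ab: "0 < a" "a < b"
  shows "(\<integral>x. v b x \<partial>lborel) = (\<integral>x. v a x \<partial>lborel)"
proof -
  define d where "d = real DIM('a)"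
  have d: "d \<ge> 1" using DIM_ge_Suc0[where 'a='a] by (simp add: d_def)
  have pd: "p * (d + s) = 2 * d" using d s by (simp add: p d_def)
  have p1: "1 < p" using d s by (simp add: p d_def[symmetric] less_divide_eq)
  have p2: "p \<le> 2" using d s by (simp add: p d_def[symmetric] divide_le_eq)
  have sp0: "0 < s * p" using s p1 by simp
  have crit: "real DIM('a) * (1 - (p - 1)) = s * p"
    using pd by (simp add: d_def algebra_simps)
  have cont: "continuous_Lq_curve 2 v" and ac: "abs_continuous_Lq_on 2 {a..b} v"
    using flow ab by (auto simp: L2_gradient_flow_def)
  have v2: "v t \<in> Lq_space 2" if "0 \<le> t" for t using cont that by (simp add: continuous_Lq_curve_def)
  obtain N w where N: "N \<in> null_sets lborel"
    and w: "\<And>t. 0 < t \<Longrightarrow> t \<notin> N \<Longrightarrow> w t \<in> Lq_space 2"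
      "\<And>t. 0 < t \<Longrightarrow> t \<notin> N \<Longrightarrow> has_Lq_derivative 2 v (w t) t"
      "\<And>t. 0 < t \<Longrightarrow> t \<notin> N \<Longrightarrow> (\<lambda>x. - 2 * w t x) \<in> L2_subdifferential (frac_p_energy s p) (v t)"
    using gradient_flow_velocity[OF flow] by metis
  define \<phi> where "\<phi> n = (cutoff (real (Suc n)) :: 'a \<Rightarrow> real)" for n
  have \<phi>2: "\<phi> n \<in> Lq_space 2" for n unfolding \<phi>_def by (rule cutoff_L2) simp
  define g where "g n t = (\<integral>x. \<phi> n x * v t x \<partial>lborel)" for n t
  define D where "D n t = (if t \<in> N then 0 else \<integral>x. \<phi> n x * w t x \<partial>lborel)" for n t
  define T where "T n t = (\<integral>\<^sup>+x. ennreal (\<bar>v t x\<bar> powr (p - 1)) * cutoff_variation (s * p) (real (Suc n)) x \<partial>lborel)" for n t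
  have DT: "ennreal \<bar>D n t\<bar> \<le> T n t" if t: "0 < t" for n t
  proof (cases "t \<in> N")
    case False
    have "ennreal \<bar>\<integral>x. (- 2 * w t x) * \<phi> n x \<partial>lborel\<bar> \<le> 2 * T n t"
      unfolding T_def \<phi>_def by (rule subgradient_cutoff_le[OF p1 p2 sp0 sp _ w(3)[OF t False]]) simp
    also have "(\<lambda>x. (- 2 * w t x) * \<phi> n x) = (\<lambda>x. - 2 * (\<phi> n x * w t x))" by (simp add: fun_eq_iff)
    also have "(\<integral>x. - 2 * (\<phi> n x * w t x) \<partial>lborel) = - 2 * D n t" using False by (simp add: D_def)
    also have "ennreal \<bar>- 2 * D n t\<bar> = 2 * ennreal \<bar>D n t\<bar>" by (simp add: abs_mult ennreal_mult)
    finally show ?thesis by (subst (asm) ennreal_mult_le_mult_iff) auto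
  qed (simp add: D_def)
  define K where "K = kernel_const TYPE('a) (s * p)"
  have K: "0 < K" unfolding K_def by (rule kernel_const_pos[OF sp0 sp])
  define c where "c = 2 * unit_ball_vol (real DIM('a)) * 2 ^ DIM('a)"
  have c: "0 \<le> c" by (simp add: c_def)
  define m where "m = (\<integral>x. \<bar>v a x\<bar> \<partial>lborel)"
  have m: "0 \<le> m" by (simp add: m_def)
  have bound: "\<bar>D n t\<bar> \<le> K * (c + m)" if t: "t \<in> {a..b}" for n t
  proof -
    have t0: "0 < t" using t ab by simp
    have vt: "integrable lborel (v t)" using v1[of t] t0 by (simp add: Lq_space_1_iff)
    have "ennreal \<bar>D n t\<bar> \<le> T n t" by (rule DT[OF t0])
    also have "\<dots> \<le> ennreal K * (ennreal c + (\<integral>\<^sup>+x. ennreal \<bar>v t x\<bar> \<partial>lborel))"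
      unfolding T_def K_def c_def
      by (rule powr_cutoff_variation_bounded[OF sp0 sp _ _ _ crit])
        (use p1 p2 vt in \<open>auto simp: borel_measurable_integrable\<close>)
    also have "(\<integral>\<^sup>+x. ennreal \<bar>v t x\<bar> \<partial>lborel) = ennreal (\<integral>x. \<bar>v t x\<bar> \<partial>lborel)"
      using vt by (intro nn_integral_eq_integral) auto
    also have "\<dots> \<le> ennreal m"
      unfolding m_def using t p1 ab(1)
      by (intro ennreal_leI gradient_flow_L1_norm_le[OF _ flow v1]) auto
    finally have "ennreal \<bar>D n t\<bar> \<le> ennreal K * (ennreal c + ennreal m)"
      by (simp add: mult_left_mono add_left_mono)
    also have "\<dots> = ennreal (K * (c + m))" using K c m by (simp add: ennreal_mult)
    finally show ?thesis using K c m by (simp add: ennreal_le_iff)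
  qed
  have lim: "(\<lambda>n. D n t) \<longlonglongrightarrow> 0" if t: "t \<in> {a..b}" for t
  proof (rule tendsto_rabs_zero_cancel, rule order_tendstoI)
    have t0: "0 < t" using t ab by simp
    have vt: "integrable lborel (v t)" using v1[of t] t0 by (simp add: Lq_space_1_iff)
    fix y :: real assume y: "0 < y"
    have "filterlim (\<lambda>n. real (Suc n)) at_top sequentially"
      by (rule filterlim_compose[OF filterlim_real_sequentially filterlim_Suc])
    moreover have "\<forall>\<^sub>F R in at_top. (\<integral>\<^sup>+x. ennreal (\<bar>v t x\<bar> powr (p - 1)) * cutoff_variation (s * p) R x \<partial>lborel) \<le> ennreal (y / 2)"
      using p1 p2 y by (intro powr_cutoff_variation_vanishes[OF sp0 sp _ _ crit vt]) auto
    ultimately have "\<forall>\<^sub>F n in sequentially. T n t \<le> ennreal (y / 2)"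
      unfolding T_def by (rule eventually_compose_filterlim[rotated])
    then show "\<forall>\<^sub>F n in sequentially. \<bar>D n t\<bar> < y"
    proof eventually_elim
      case (elim n)
      have "ennreal \<bar>D n t\<bar> \<le> ennreal (y / 2)" using DT[OF t0] elim by (rule order_trans)
      then show ?case using y by (simp add: ennreal_le_iff)
    qed
  next
    fix y :: real assume "y < 0"
    then show "\<forall>\<^sub>F n in sequentially. y < \<bar>D n t\<bar>" by (intro always_eventually) auto
  qed
  have int: "(D n has_integral (g n b - g n a)) {a..b}" for n
  proof (rule absolutely_continuous_has_integral_derivative[OF _ _ N])
    show "a \<le> b" using ab by simp
    have lip: "\<bar>g n t - g n r\<bar> \<le> Lq_norm 2 (\<phi> n) * Lq_dist 2 (v t) (v r)" if "t \<in> {a..b}" "r \<in> {a..b}" for t r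
    proof -
      have 2: "v t \<in> Lq_space 2" "v r \<in> Lq_space 2" using that ab v2 by auto
      have "g n t - g n r = (\<integral>x. \<phi> n x * (v t x - v r x) \<partial>lborel)"
        unfolding g_def right_diff_distrib
        by (rule Bochner_Integration.integral_diff[symmetric]) (intro L2_mult_integrable \<phi>2 2)+
      then show ?thesis using L2_Cauchy_Schwarz[OF \<phi>2 L2_diff[OF 2]] by (simp add: Lq_dist_def)
    qed
    fix \<epsilon> :: real assume "\<epsilon> > 0"
    then show "\<exists>\<delta>>0. \<forall>\<D>. \<D> division_of (\<Union>\<D>) \<and> \<Union>\<D> \<subseteq> {a..b} \<and>
        (\<Sum>K\<in>\<D>. Sup K - Inf K) < \<delta> \<longrightarrow> (\<Sum>K\<in>\<D>. \<bar>g n (Sup K) - g n (Inf K)\<bar>) < \<epsilon>"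
      by (intro abs_continuous_Lq_on_functional[OF ac Lq_norm_nonneg lip])
  next
    fix t assume "t \<in> {a..b} - N"
    then have t: "0 < t" "t \<notin> N" using ab by auto
    then show "(g n has_real_derivative D n t) (at t)"
      unfolding g_def[abs_def] D_def
      using has_real_derivative_inner[OF t(1) v2 w(1)[OF t] \<phi>2 w(2)[OF t]] by simp
  next
    fix t assume "t \<in> N" then show "D n t = 0" by (simp add: D_def)
  qed
  have "(\<lambda>n. integral {a..b} (D n)) \<longlonglongrightarrow> integral {a..b} (\<lambda>_. 0 :: real)"
  proof (rule dominated_convergence(2))
    show "D n integrable_on {a..b}" for n using int by (rule has_integral_integrable)
    show "(\<lambda>_. K * (c + m)) integrable_on {a..b}" by (rule integrable_const_ivl)
    show "norm (D n t) \<le> K * (c + m)" if "t \<in> {a..b}" for n t using bound[OF that] by simp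
  qed (rule lim)
  then have "(\<lambda>n. g n b - g n a) \<longlonglongrightarrow> 0" by (simp add: integral_unique[OF int])
  moreover have "(\<lambda>n. g n b - g n a) \<longlonglongrightarrow> (\<integral>x. v b x \<partial>lborel) - (\<integral>x. v a x \<partial>lborel)"
    unfolding g_def \<phi>_def
    using v1[of a] v1[of b] ab by (intro tendsto_diff cutoff_integral_tendsto) (auto simp: Lq_space_1_iff)
  ultimately have "(\<integral>x. v b x \<partial>lborel) - (\<integral>x. v a x \<partial>lborel) = 0" by (rule LIMSEQ_unique[symmetric])
  then show ?thesis by simp
qed

theorem theorem12p4:
  fixes s p :: real
    and u0 :: "'a::euclidean_space \<Rightarrow> real"
    and u :: "real \<Rightarrow> 'a \<Rightarrow> real"
  assumes "0 < s" and "s < 1"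
    and "p = 2 * real DIM('a) / (real DIM('a) + s)"
    and "s * p < 1"
    and "integrable lborel u0" and "AE x in lborel. 0 \<le> u0 x"
    and "L1_semigroup_solution s p u0 u"
    and "\<forall>t\<ge>0. AE x in lborel. 0 \<le> u t x"
  shows "\<forall>t>0. (\<integral>x. u t x \<partial>lborel) = (\<integral>x. u0 x \<partial>lborel)"
proof (intro allI impI)
  fix t :: real assume t: "0 < t"
  have cont: "continuous_Lq_curve 1 u" and init: "AE x in lborel. u 0 x = u0 x"
    using assms(7) by (auto simp: L1_semigroup_solution_def)
  obtain v where v: "\<And>n::nat. L2_gradient_flow s p (v n)"
      "\<And>n t. 0 \<le> t \<Longrightarrow> v n t \<in> Lq_space 1"
      "\<And>t. 0 \<le> t \<Longrightarrow> (\<lambda>n. Lq_dist 1 (v n t) (u t)) \<longlonglongrightarrow> 0"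
    using assms(7) unfolding L1_semigroup_solution_def by blast
  have u1: "u r \<in> Lq_space 1" if "0 \<le> r" for r using cont that by (simp add: continuous_Lq_curve_def)
  have mass_lim: "(\<lambda>n. \<integral>x. v n r x \<partial>lborel) \<longlonglongrightarrow> (\<integral>x. u r x \<partial>lborel)" if r: "0 \<le> r" for r
  proof (rule LIM_zero_cancel, rule Lim_null_comparison[OF _ v(3)[OF r]])
    show "\<forall>\<^sub>F n in sequentially. norm ((\<integral>x. v n r x \<partial>lborel) - (\<integral>x. u r x \<partial>lborel)) \<le> Lq_dist 1 (v n r) (u r)"
      using abs_integral_diff_le_Lq_dist_1[OF v(2)[OF r] u1[OF r]] by (intro always_eventually) simp
  qed
  \<comment> \<open>Conservation between two positive times; \<open>r\<close> will tend to \<open>0\<close>.\<close>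
  have const: "(\<integral>x. u r x \<partial>lborel) = (\<integral>x. u t x \<partial>lborel)" if r: "0 < r" "r < t" for r
  proof (rule LIMSEQ_unique[OF mass_lim])
    have "(\<integral>x. v n t x \<partial>lborel) = (\<integral>x. v n r x \<partial>lborel)" for n
      by (rule gradient_flow_mass_eq[OF assms(1-4) v(1) v(2) r])
    then show "(\<lambda>n. \<integral>x. v n r x \<partial>lborel) \<longlonglongrightarrow> (\<integral>x. u t x \<partial>lborel)"
      using mass_lim[of t] t by simp
  qed (use r in simp)
  have "((\<lambda>r. Lq_dist 1 (u r) (u 0)) \<longlongrightarrow> 0) (at 0 within {0..})"
    using cont by (simp add: continuous_Lq_curve_def)
  then have "((\<lambda>r. Lq_dist 1 (u r) (u 0)) \<longlongrightarrow> 0) (at_right 0)"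
    by (rule tendsto_within_subset) auto
  then have "((\<lambda>r. \<integral>x. u r x \<partial>lborel) \<longlongrightarrow> (\<integral>x. u 0 x \<partial>lborel)) (at_right 0)"
  proof (rule LIM_zero_cancel[OF Lim_null_comparison, rotated])
    show "\<forall>\<^sub>F r in at_right 0. norm ((\<integral>x. u r x \<partial>lborel) - (\<integral>x. u 0 x \<partial>lborel)) \<le> Lq_dist 1 (u r) (u 0)"
      using eventually_at_right_less[of "0::real"]
      by eventually_elim (use abs_integral_diff_le_Lq_dist_1[OF u1 u1] in simp)
  qed
  moreover have "((\<lambda>r. \<integral>x. u r x \<partial>lborel) \<longlongrightarrow> (\<integral>x. u t x \<partial>lborel)) (at_right 0)"
  proof (rule tendsto_eventually)
    have "\<forall>\<^sub>F r in at_right 0. r < t" by (rule order_tendstoD(2)[OF tendsto_ident_at t])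
    then show "\<forall>\<^sub>F r in at_right 0. (\<integral>x. u r x \<partial>lborel) = (\<integral>x. u t x \<partial>lborel)"
      using eventually_at_right_less[of "0::real"] by eventually_elim (rule const)
  qed
  ultimately have "(\<integral>x. u t x \<partial>lborel) = (\<integral>x. u 0 x \<partial>lborel)"
    by (intro tendsto_unique[OF trivial_limit_at_right_real])
  also have "\<dots> = (\<integral>x. u0 x \<partial>lborel)"
    using init assms(5) measurable_Lq_space[OF u1[of 0]]
    by (intro integral_cong_AE) (auto simp: borel_measurable_integrable)
  finally show "(\<integral>x. u t x \<partial>lborel) = (\<integral>x. u0 x \<partial>lborel)" .
qed

end
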